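(* For every $n$, there are only finitely many equivalence classes of perfect quadratic functions in $n$ variables lying in the positive Erdahl cone, and only finitely many equivalence classes of weakly eutactic quadratic functions in $n$ variables lying in the positive Erdahl cone.
   Context: A quadratic function in $n$ variables is $f(x)=\alpha_f+2b_f\cdot x+Q_f[x]$ with $\alpha_f\in\mathbb{R}$, $b_f\in\mathbb{R}^n$, $Q_f$ real symmetric, $Q[x]=x^tQx$; the space has inner product $(f,g)=\alpha_f\alpha_g+2b_f\cdot b_g+\mathrm{tr}(Q_fQ_g)$, symmetric matrices $M$ are identified with the quadratic function with $\alpha=0,b=0$ and quadratic part $M$, and $\mathrm{ev}_x$ is $y\mapsto(1+x\cdot y)^2$. The positive Erdahl cone is the set of $f$ with $f(v)\ge0$ for all $v\in\mathbb{Z}^n$ and $Q_f$ positive definite. For such $f$: $\mu(f)=-\min_xf(x)$, $c_f=-Q_f^{-1}b_f$, $\mathrm{Del}\,f=\mathrm{conv}\{v\in\mathbb{Z}^n: f(v)=0\}$. $f$ is perfect if $\{\mathrm{ev}_v: v \text{ vertex of }\mathrm{Del}\,f\}$ spans a space of dimension $\binom{n+2}{2}-1$; weakly eutactic if there are real numbers $\alpha_v$ (over vertices $v$ of $\mathrm{Del}\,f$) with $\sum_v\alpha_v\mathrm{ev}_v=\mathrm{ev}_{c_f}+\frac{\mu(f)}{n}Q_f^{-1}$. Two quadratic functions $f,g$ are equivalent if there are $\lambda>0$ and $u(x)=v+Ax$ with $v\in\mathbb{Z}^n$, $A\in\mathrm{GL}_n(\mathbb{Z})$ such that $f(x)=\lambda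 g(u(x))$ for all $x$.
   Formalization: For n ≥ 2 the weakly eutactic half is restricted to functions with μ(f) ≠ 0: every f(x)=Q[x] with Q positive definite has μ(f)=0 and is trivially weakly eutactic, giving infinitely many classes. Also n ≥ 1 is assumed. *)

theory Defs
  imports "HOL-Analysis.Analysis"
begin

(* The triple (alpha, b, Q) stands for the function x |-> alpha + 2 b.x + x^t Q x.
   It is determined by the function once Q is symmetric, so the space of quadratic
   functions is the subspace quadratic_functions below. *)
type_synonym 'n quadratic = "real \<times> (real, 'n) vec \<times> ((real, 'n) vec, 'n) vec"

definition alpha_of :: "'n::finite quadratic \<Rightarrow> real"
  where "alpha_of f = fst f"

definition b_of :: "'n::finite quadratic \<Rightarrow> real^'n"
  where "b_of f = fst (snd f)"

definition Q_of :: "'n::finite quadratic \<Rightarrow> real^'n^'n"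
  where "Q_of f = snd (snd f)"

definition quadratic_functions :: "'n::finite quadratic set"
  where "quadratic_functions = {f. transpose (Q_of f) = Q_of f}"

definition qform :: "real^'n^'n \<Rightarrow> real^'n \<Rightarrow> real"
  where "qform Q x = x \<bullet> (Q *v x)"

definition qeval :: "'n::finite quadratic \<Rightarrow> real^'n \<Rightarrow> real"
  where "qeval f x = alpha_of f + 2 * (b_of f \<bullet> x) + qform (Q_of f) x"

definition pos_def :: "real^'n^'n \<Rightarrow> bool"
  where "pos_def Q \<longleftrightarrow> transpose Q = Q \<and> (\<forall>x. x \<noteq> 0 \<longrightarrow> qform Q x > 0)"

definition of_matrix :: "real^'n^'n \<Rightarrow> 'n::finite quadratic"
  where "of_matrix M = (0, 0, M)"

definition ev :: "real^'n \<Rightarrow> 'n::finite quadratic"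
  where "ev x = (1, x, \<chi> i j. x $ i * x $ j)"

lemma qeval_ev: "qeval (ev x) y = (1 + x \<bullet> y)\<^sup>2"
proof -
  have "qform (\<chi> i j. x $ i * x $ j) y = (x \<bullet> y)\<^sup>2"
    by (simp add: qform_def inner_vec_def matrix_vector_mult_def power2_eq_square
        sum_product sum_distrib_left algebra_simps)
  then show ?thesis
    by (simp add: qeval_def ev_def alpha_of_def b_of_def Q_of_def power2_sum)
qed

definition int_vecs :: "(real^'n) set"
  where "int_vecs = {v. \<forall>i. v $ i \<in> \<int>}"

definition int_mats :: "(real^'n^'n) set"
  where "int_mats = {A. \<forall>i j. A $ i $ j \<in> \<int>}"

definition GL_int :: "(real^'n^'n) set"
  where "GL_int = {A \<in> int_mats. \<exists>B\<in>int_mats. A ** B = mat 1 \<and> B ** A = mat 1}"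

definition positive_erdahl_cone :: "'n::finite quadratic set"
  where "positive_erdahl_cone =
    {f \<in> quadratic_functions. (\<forall>v\<in>int_vecs. 0 \<le> qeval f v) \<and> pos_def (Q_of f)}"

(* The infimum is attained whenever Q_of f is positive definite. *)
definition mu :: "'n::finite quadratic \<Rightarrow> real"
  where "mu f = - (INF x. qeval f x)"

definition center :: "'n::finite quadratic \<Rightarrow> real^'n"
  where "center f = - (matrix_inv (Q_of f) *v b_of f)"

definition Del :: "'n::finite quadratic \<Rightarrow> (real^'n) set"
  where "Del f = convex hull {v \<in> int_vecs. qeval f v = 0}"

definition Del_vertices :: "'n::finite quadratic \<Rightarrow> (real^'n) set"
  where "Del_vertices f = {v. v extreme_point_of Del f}"

definition perfect :: "'n::finite quadratic \<Rightarrow> bool"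
  where "perfect f \<longleftrightarrow> dim (span (ev ` Del_vertices f)) = ((CARD('n) + 2) choose 2) - 1"

(* Del_vertices f is finite for f in the positive Erdahl cone, so the sum is a genuine one there.
   Pitfall: if mu f = 0 and Del f is nonempty, then f(x) = Q_f[x - v] for some integral v, Del f = {v},
   and the equation holds trivially with coefficient 1, whatever Q_f is. For n \<ge> 2 these
   degenerate functions already form infinitely many equivalence classes, so a finiteness
   statement has to leave them out. *)
definition weakly_eutactic :: "'n::finite quadratic \<Rightarrow> bool"
  where "weakly_eutactic f \<longleftrightarrow>
    (\<exists>a :: real^'n \<Rightarrow> real. (\<Sum>v\<in>Del_vertices f. a v *\<^sub>R ev v) =
       ev (center f) + (mu f / real CARD('n)) *\<^sub>R of_matrix (matrix_inv (Q_of f)))"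

definition quad_equiv :: "('n::finite quadratic \<times> 'n quadratic) set"
  where "quad_equiv = {(f, g). f \<in> quadratic_functions \<and> g \<in> quadratic_functions \<and>
    (\<exists>c>0. \<exists>v\<in>int_vecs. \<exists>A\<in>GL_int. \<forall>x. qeval f x = c * qeval g (v + A *v x))}"

lemma int_mats_mult: "A \<in> int_mats \<Longrightarrow> B \<in> int_mats \<Longrightarrow> A ** B \<in> int_mats"
  by (auto simp: int_mats_def matrix_matrix_mult_def intro!: Ints_sum Ints_mult)

lemma int_mats_mult_vec: "A \<in> int_mats \<Longrightarrow> v \<in> int_vecs \<Longrightarrow> A *v v \<in> int_vecs"
  by (auto simp: int_mats_def int_vecs_def matrix_vector_mult_def intro!: Ints_sum Ints_mult)

lemma GL_int_mult: 
  assumes "A \<in> GL_int" "B \<in> GL_int"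
  shows "A ** B \<in> GL_int"
proof -
  obtain A' B' where i: "A \<in> int_mats" "A' \<in> int_mats" "B \<in> int_mats" "B' \<in> int_mats"
    and e: "A ** A' = mat 1" "A' ** A = mat 1" "B ** B' = mat 1" "B' ** B = mat 1"
    using assms by (auto simp: GL_int_def)
  have "A ** B ** (B' ** A') = A ** (B ** B') ** A'"
    and "B' ** A' ** (A ** B) = B' ** (A' ** A) ** B"
    by (simp_all add: matrix_mul_assoc)
  then show ?thesis
    using i e by (auto simp: GL_int_def int_mats_mult intro!: bexI[of _ "B' ** A'"])
qed

lemma equiv_quad_equiv: "equiv (quadratic_functions :: 'n::finite quadratic set) quad_equiv"
proof (rule equivI)
  show "quad_equiv \<subseteq> quadratic_functions \<times> (quadratic_functions :: 'n quadratic set)"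
    by (auto simp: quad_equiv_def)
  have "(mat 1 :: real^'n^'n) \<in> int_mats"
    by (auto simp: int_mats_def mat_def)
  then have "(mat 1 :: real^'n^'n) \<in> GL_int"
    by (auto simp: GL_int_def intro!: bexI[of _ "mat 1"])
  moreover have "(0 :: real^'n) \<in> int_vecs"
    by (simp add: int_vecs_def)
  ultimately show "refl_on (quadratic_functions :: 'n quadratic set) (quad_equiv :: ('n quadratic \<times> _) set)"
    unfolding refl_on_def quad_equiv_def
    by (auto intro!: exI[of _ 1] bexI[of _ "0 :: real^'n"] bexI[of _ "mat 1"])
  show "sym (quad_equiv :: ('n quadratic \<times> _) set)"
  proof (rule symI)
    fix f g :: "'n quadratic" assume "(f, g) \<in> quad_equiv"
    then obtain c v A where fg: "f \<in> quadratic_functions" "g \<in> quadratic_functions"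
      and c: "c > 0" and v: "v \<in> int_vecs" and A: "A \<in> GL_int"
      and eq: "\<And>x. qeval f x = c * qeval g (v + A *v x)"
      by (auto simp: quad_equiv_def)
    obtain B where B: "B \<in> int_mats" "A ** B = mat 1" "B ** A = mat 1" "A \<in> int_mats"
      using A by (auto simp: GL_int_def)
    have "v + A *v (- (B *v v) + B *v x) = x" for x
    proof -
      have "- (B *v v) + B *v x = B *v (x - v)"
        by (simp add: matrix_vector_mult_diff_distrib)
      then show ?thesis
        by (simp add: matrix_vector_mul_assoc B)
    qed
    then have "qeval g x = (1 / c) * qeval f (- (B *v v) + B *v x)" for x
      using c by (simp add: eq)
    moreover have "- (B *v v) \<in> int_vecs"
      using int_mats_mult_vec[OF B(1) v] by (simp add: int_vecs_def)
    moreover have "B \<in> GL_int" using B by (auto simp: GL_int_def)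
    moreover have "1 / c > 0" using c by simp
    ultimately show "(g, f) \<in> quad_equiv"
      using fg unfolding quad_equiv_def by blast
  qed
  show "trans (quad_equiv :: ('n quadratic \<times> _) set)"
  proof (rule transI)
    fix f g h :: "'n quadratic" assume "(f, g) \<in> quad_equiv" "(g, h) \<in> quad_equiv"
    then obtain c v A d w B where fh: "f \<in> quadratic_functions" "h \<in> quadratic_functions"
      and c: "c > 0" "d > 0" and v: "v \<in> int_vecs" "w \<in> int_vecs"
      and A: "A \<in> GL_int" "B \<in> GL_int"
      and eq: "\<And>x. qeval f x = c * qeval g (v + A *v x)"
        "\<And>x. qeval g x = d * qeval h (w + B *v x)"
      by (auto simp: quad_equiv_def)
    have "qeval f x = (c * d) * qeval h ((w + B *v v) + (B ** A) *v x)" for x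
      by (simp add: eq matrix_vector_right_distrib matrix_vector_mul_assoc add.assoc)
    moreover have "B *v v \<in> int_vecs" using A v by (simp add: GL_int_def int_mats_mult_vec)
    then have "w + B *v v \<in> int_vecs" using v by (simp add: int_vecs_def)
    moreover have "c * d > 0" using c by simp
    ultimately show "(f, h) \<in> quad_equiv"
      using fh GL_int_mult[OF A(2,1)] unfolding quad_equiv_def by blast
  qed
qed

end

theory Submission
  imports Defs
begin

text \<open>
  Fix an inscribed lattice simplex with vertices \<open>v\<close>, \<open>v + B e\<^sub>i\<close> among the integral zeros of \<open>f\<close>.
  If an integral vector \<open>w\<close> had small nonzero coordinates in the frame \<open>B\<close>, then one of the
  inequalities \<open>f (y \<plusminus> w) \<ge> 0\<close> at a vertex \<open>y\<close> would fail; with Dirichlet's approximation theorem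
  this gives a common denominator, depending only on \<open>n\<close>, of all integral vectors in the frame.
  Choosing the frame with \<open>\<bar>det B\<bar>\<close> maximal, all zeros have coordinates in \<open>[-1, 1]\<close>. So the lattice
  and the zeros, read in the frame, range over finitely many possibilities, and two functions with
  the same data have zero sets related by an affine unimodular map.

  It remains to see that \<open>f\<close> is determined up to scaling by its zeros. For perfect \<open>f\<close> this is a
  dimension count. If \<open>f\<close> and \<open>g\<close> are weakly eutactic with the same zeros, pairing the eutaxy relation
  of each with the other yields \<open>tr (Q\<^sub>g Q\<^sub>f\<^sup>-\<^sup>1) \<le> n \<mu>\<^sub>g / \<mu>\<^sub>f\<close> and vice versa, which forces
  equality in the arithmetic-harmonic mean inequality and hence proportionality.
\<close>

section \<open>Positive definite matrices and traces\<close>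

text \<open>All integral zeros rather than the vertices of \<open>Del f\<close>: affine unimodular
  maps carry zero sets to zero sets directly, and the vertices lie among the zeros, which suffices
  for perfection and eutaxy alike.\<close>

definition zeros :: "'n::finite quadratic \<Rightarrow> (real^'n) set"
  where "zeros f = {v \<in> int_vecs. qeval f v = 0}"

lemma symmetric_inner_commute:
  fixes Q :: "real^'n^'n"
  assumes "transpose Q = Q"
  shows "x \<bullet> (Q *v y) = y \<bullet> (Q *v x)"
  by (metis assms dot_lmul_matrix inner_commute transpose_matrix_vector)

lemma qform_add:
  fixes Q :: "real^'n^'n"
  assumes "transpose Q = Q"
  shows "qform Q (x + y) = qform Q x + 2 * ((Q *v x) \<bullet> y) + qform Q y"
  using symmetric_inner_commute[OF assms, of x y]
  by (simp add: qform_def matrix_vector_right_distrib inner_add_left inner_add_right inner_commute[of y])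

lemma qform_uminus [simp]: "qform Q (- x) = qform Q x"
  using matrix_vector_mult_scaleR[of Q "-1" x] by (simp add: qform_def)

lemma qform_zero [simp]: "qform Q 0 = 0"
  by (simp add: qform_def)

lemma qform_diff_matrix: "qform (P - R) x = qform P x - qform R x"
  by (simp add: qform_def matrix_vector_mult_diff_rdistrib inner_diff_right)

lemma qeval_add:
  assumes "f \<in> quadratic_functions"
  shows "qeval f (x + y) = qeval f x + 2 * ((b_of f + Q_of f *v x) \<bullet> y) + qform (Q_of f) y"
  using assms
  by (simp add: quadratic_functions_def qeval_def qform_add inner_add_right inner_add_left)

lemma pos_def_qform_nonneg: "pos_def Q \<Longrightarrow> 0 \<le> qform Q x"
  by (cases "x = 0") (auto simp: pos_def_def less_imp_le)

lemma pos_def_qform_eq_0: "pos_def Q \<Longrightarrow> qform Q x = 0 \<longleftrightarrow> x = 0"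
  by (auto simp: pos_def_def)

lemma pos_def_symmetric: "pos_def Q \<Longrightarrow> transpose Q = Q"
  by (simp add: pos_def_def)

lemma pos_def_matrix_inv:
  fixes Q :: "real^'n^'n"
  assumes "pos_def Q"
  shows "Q ** matrix_inv Q = mat 1" "matrix_inv Q ** Q = mat 1"
proof -
  have "\<forall>x. Q *v x = 0 \<longrightarrow> x = 0"
    using assms by (auto simp: pos_def_def qform_def)
  then obtain P where "P ** Q = mat 1"
    using matrix_left_invertible_ker by blast
  then have "invertible Q"
    by (metis invertible_def matrix_left_right_inverse)
  then show "Q ** matrix_inv Q = mat 1" "matrix_inv Q ** Q = mat 1"
    unfolding matrix_inv_def invertible_def by (metis (mono_tags, lifting) someI_ex)+
qed

lemma matrix_inv_eqI:
  fixes A B :: "real^'n^'n"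
  assumes "A ** B = mat 1"
  shows "matrix_inv A = B"
proof -
  have "B ** A = mat 1"
    using assms matrix_left_right_inverse by blast
  then have "A ** matrix_inv A = mat 1"
    using assms unfolding matrix_inv_def by (rule_tac someI2[of _ B]) auto
  then show ?thesis
    by (metis \<open>B ** A = mat 1\<close> matrix_mul_assoc matrix_mul_lid matrix_mul_rid)
qed

lemma pos_def_inverse:
  fixes Q :: "real^'n^'n"
  assumes "pos_def Q"
  shows "pos_def (matrix_inv Q)"
proof -
  note inv = pos_def_matrix_inv[OF assms] and sym = pos_def_symmetric[OF assms]
  have "Q ** transpose (matrix_inv Q) = mat 1"
    by (metis inv(2) matrix_transpose_mul sym transpose_mat)
  then have "transpose (matrix_inv Q) = matrix_inv Q"
    by (metis matrix_inv_eqI)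
  moreover have "qform (matrix_inv Q) x > 0" if "x \<noteq> 0" for x
  proof -
    have "x = Q *v (matrix_inv Q *v x)"
      by (simp add: matrix_vector_mul_assoc inv)
    then have "qform (matrix_inv Q) x = qform Q (matrix_inv Q *v x)" "matrix_inv Q *v x \<noteq> 0"
      using that by (metis qform_def inner_commute, metis matrix_vector_mult_0_right)
    then show ?thesis
      using assms by (simp add: pos_def_def)
  qed
  ultimately show ?thesis
    by (simp add: pos_def_def)
qed

lemma qform_outer:
  fixes a :: "real^'n"
  shows "qform (\<chi> i j. a $ i * a $ j) x = (a \<bullet> x)\<^sup>2"
  by (simp add: qform_def inner_vec_def matrix_vector_mult_def power2_eq_square
        sum_product sum_distrib_left algebra_simps)

lemma trace_outer_mult:
  fixes a :: "real^'n"
  shows "trace ((\<chi> i j. a $ i * a $ j) ** B) = qform B a"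
proof -
  have "trace ((\<chi> i j. a $ i * a $ j) ** B) = (\<Sum>i\<in>UNIV. \<Sum>j\<in>UNIV. a $ i * a $ j * B $ j $ i)"
    by (simp add: trace_def matrix_matrix_mult_def)
  also have "\<dots> = (\<Sum>j\<in>UNIV. \<Sum>i\<in>UNIV. a $ i * a $ j * B $ j $ i)"
    by (rule sum.swap)
  also have "\<dots> = qform B a"
    by (simp add: qform_def inner_vec_def matrix_vector_mult_def sum_distrib_left algebra_simps)
  finally show ?thesis .
qed

lemma qform_axis: "qform A (axis k 1) = A $ k $ k"
  by (simp add: qform_def matrix_vector_mult_basis column_def inner_axis')

text \<open>Along \<open>t *\<^sub>R axis k 1 + axis j 1\<close> the form is affine in
  \<open>t\<close>, with slope \<open>2 * A $ k $ j\<close>; a nonzero slope would make it negative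
  somewhere.\<close>

lemma psd_zero_diagonal:
  fixes A :: "real^'n^'n"
  assumes sym: "transpose A = A" and psd: "\<And>x. 0 \<le> qform A x" and "A $ k $ k = 0"
  shows "A $ k $ j = 0"
proof (rule ccontr)
  assume nz: "A $ k $ j \<noteq> 0"
  define t where "t = - (A $ j $ j + 1) / (2 * A $ k $ j)"
  have "A *v (t *\<^sub>R axis k 1) = t *\<^sub>R column k A"
    by (simp add: matrix_vector_mult_scaleR matrix_vector_mult_basis)
  moreover have "A $ j $ k = A $ k $ j"
    using sym by (metis transpose_def vec_lambda_beta)
  ultimately have "qform A (t *\<^sub>R axis k 1 + axis j 1) = 2 * t * A $ k $ j + A $ j $ j"
    using assms(3)
    by (simp add: qform_add[OF sym] qform_axis) (simp add: qform_def column_def inner_axis inner_axis')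
  also have "\<dots> = - 1"
    using nz by (simp add: t_def field_simps)
  finally show False
    using psd[of "t *\<^sub>R axis k 1 + axis j 1"] by simp
qed

text \<open>One step of symmetric Gaussian elimination writes a semidefinite matrix as a rank-one
  semidefinite matrix plus a semidefinite matrix with fewer nonzero diagonal entries.\<close>

lemma trace_psd_mult:
  fixes A B :: "real^'n^'n"
  assumes "pos_def B" "transpose A = A" "\<And>x. 0 \<le> qform A x"
  shows "0 \<le> trace (A ** B) \<and> (A \<noteq> 0 \<longrightarrow> 0 < trace (A ** B))"
  using assms(2,3)
proof (induction "card {k. A $ k $ k \<noteq> 0}" arbitrary: A rule: less_induct)
  case less
  show ?case
  proof (cases "\<exists>k. A $ k $ k \<noteq> 0")
    case False
    then have "A $ i $ j = 0" for i j
      using psd_zero_diagonal[OF less.prems] by blast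
    then have "A = 0"
      by (simp add: vec_eq_iff)
    then show ?thesis
      by (simp add: trace_def)
  next
    case True
    then obtain k where nz: "A $ k $ k \<noteq> 0" by blast
    define a where "a = A $ k"
    define d where "d = A $ k $ k"
    have d: "d > 0"
      using less.prems(2)[of "axis k 1"] nz by (simp add: qform_axis d_def)
    define C where "C = (\<chi> i j. a $ i * a $ j) "
    define A' where "A' = A - (1 / d) *\<^sub>R C"
    have A_sym: "A $ i $ j = A $ j $ i" for i j
      using less.prems(1) by (metis transpose_def vec_lambda_beta)
    have Ae: "A *v axis k 1 = a"
      by (simp add: matrix_vector_mult_basis vec_eq_iff column_def a_def A_sym)
    have sym': "transpose A' = A'"
      by (simp add: A'_def C_def transpose_def vec_eq_iff A_sym)
    have C: "qform ((1 / d) *\<^sub>R C) x = (a \<bullet> x)\<^sup>2 / d" for x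
      using qform_outer[of a x] by (simp add: C_def qform_def scaleR_matrix_vector_assoc[symmetric])
    have psd': "0 \<le> qform A' x" for x
    proof -
      \<comment> \<open>Minimiser of the form of \<open>A\<close> along
        \<open>t *\<^sub>R axis k 1 + x\<close>; the minimum is \<open>qform A' x\<close>, so
        \<open>A'\<close> inherits nonnegativity.\<close>
      define t where "t = - (a \<bullet> x) / d"
      have "A *v (t *\<^sub>R axis k 1) = t *\<^sub>R a"
        by (simp add: matrix_vector_mult_scaleR Ae)
      then have "qform A (t *\<^sub>R axis k 1 + x) = t\<^sup>2 * d + 2 * t * (a \<bullet> x) + qform A x"
        by (simp add: qform_add[OF less.prems(1)])
          (simp add: qform_def inner_axis' a_def d_def power2_eq_square)
      also have "\<dots> = qform A x - (a \<bullet> x)\<^sup>2 / d"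
        using d by (simp add: t_def field_simps power2_eq_square)
      also have "\<dots> = qform A' x"
        by (simp add: A'_def qform_diff_matrix C)
      finally show ?thesis
        using less.prems(2) by metis
    qed
    have "A' $ i $ i = 0" if "A $ i $ i = 0" for i
    proof -
      have "a $ i = 0"
        using psd_zero_diagonal[OF less.prems that, of k] A_sym by (simp add: a_def)
      then show ?thesis
        using that by (simp add: A'_def C_def)
    qed
    moreover have "A' $ k $ k = 0"
      using d by (simp add: A'_def C_def a_def d_def)
    ultimately have "{k. A' $ k $ k \<noteq> 0} \<subset> {k. A $ k $ k \<noteq> 0}"
      using nz by blast
    then have "card {k. A' $ k $ k \<noteq> 0} < card {k. A $ k $ k \<noteq> 0}"
      by (simp add: psubset_card_mono)
    then have "0 \<le> trace (A' ** B)"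
      using less.hyps[of A'] sym' psd' by blast
    moreover have "a \<noteq> 0"
      using nz by (auto simp: a_def)
    then have "trace (C ** B) > 0"
      using assms(1) by (simp add: C_def trace_outer_mult pos_def_def)
    moreover have "A = A' + (1 / d) *\<^sub>R C"
      by (simp add: A'_def)
    then have "A ** B = A' ** B + (1 / d) *\<^sub>R (C ** B)"
      by (simp add: vec_eq_iff matrix_matrix_mult_def sum.distrib sum_distrib_left algebra_simps)
    then have "trace (A ** B) = trace (A' ** B) + (1 / d) * trace (C ** B)"
      by (simp add: trace_def sum.distrib sum_distrib_left sum_divide_distrib)
    ultimately show ?thesis
      using d by (smt (verit) divide_pos_pos mult_pos_pos zero_less_one)
  qed
qed

section \<open>Inscribed lattice simplices\<close>

lemma int_vecs_add: "x \<in> int_vecs \<Longrightarrow> y \<in> int_vecs \<Longrightarrow> x + y \<in> int_vecs"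
  by (simp add: int_vecs_def)

lemma int_vecs_diff: "x \<in> int_vecs \<Longrightarrow> y \<in> int_vecs \<Longrightarrow> x - y \<in> int_vecs"
  by (simp add: int_vecs_def)

lemma int_vecs_scaleR: "r \<in> \<int> \<Longrightarrow> x \<in> int_vecs \<Longrightarrow> r *\<^sub>R x \<in> int_vecs"
  by (simp add: int_vecs_def)

lemma axis_int_vecs: "axis i 1 \<in> int_vecs"
  by (simp add: int_vecs_def axis_def)

lemma int_mats_iff_columns: "A \<in> int_mats \<longleftrightarrow> (\<forall>j. A *v axis j 1 \<in> int_vecs)"
  by (auto simp: int_mats_def int_vecs_def matrix_vector_mult_basis column_def)

lemma int_mats_iff_maps_int_vecs: "A \<in> int_mats \<longleftrightarrow> (\<forall>v\<in>int_vecs. A *v v \<in> int_vecs)"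
  using int_mats_iff_columns axis_int_vecs int_mats_mult_vec by blast

lemma matrix_vector_mult_axis_sum: "A *v x = (\<Sum>i\<in>UNIV. x $ i *\<^sub>R (A *v axis i 1))"
  for x :: "real^'n"
proof -
  have "(\<Sum>i\<in>UNIV. x $ i *\<^sub>R axis i 1) = x"
    by (simp add: vec_eq_iff axis_def if_distrib cong: if_cong)
  then have "A *v x = A *v (\<Sum>i\<in>UNIV. x $ i *\<^sub>R axis i 1)"
    by simp
  also have "\<dots> = (\<Sum>i\<in>UNIV. A *v (x $ i *\<^sub>R axis i 1))"
    by (rule linear_sum) (rule matrix_vector_mul_linear)
  finally show ?thesis
    by (simp add: matrix_vector_mult_scaleR)
qed

text \<open>Expanding \<open>f\<close> at \<open>v + w\<close> and \<open>v - w\<close> around the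
  zero \<open>v\<close> leaves plus or minus twice the linear term plus
  \<open>qform (Q_of f) w\<close>, and both values are nonnegative.\<close>

lemma erdahl_gradient_bound:
  assumes "f \<in> positive_erdahl_cone" "v \<in> zeros f" "w \<in> int_vecs"
  shows "2 * \<bar>(b_of f + Q_of f *v v) \<bullet> w\<bar> \<le> qform (Q_of f) w"
proof -
  have "v + w \<in> int_vecs" "v + - w \<in> int_vecs" "qeval f v = 0"
    using assms(2,3) by (auto simp: zeros_def int_vecs_def)
  then have "0 \<le> qeval f (v + w)" "0 \<le> qeval f (v + - w)" "qeval f v = 0"
      "f \<in> quadratic_functions"
    using assms(1) by (simp_all add: positive_erdahl_cone_def del: add_uminus_conv_diff)
  then show ?thesis
    using qeval_add[of f v w] qeval_add[of f v "- w"] by simp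
qed

lemma dirichlet_vec:
  fixes x :: "real^'n" and N :: nat
  assumes "N > 0"
  obtains q :: nat and p where "0 < q" "q \<le> N ^ CARD('n)" "p \<in> int_vecs"
    "\<And>i. \<bar>(real q *\<^sub>R x - p) $ i\<bar> < 1 / N"
proof -
  obtain h :: "'n \<Rightarrow> nat" where h: "bij_betw h UNIV {0..<CARD('n)}"
    using ex_bij_betw_finite_nat[of "UNIV :: 'n set"] by auto
  obtain q p where q: "0 < q" "q \<le> int (N ^ CARD('n))"
    and p: "\<And>i. i < CARD('n) \<Longrightarrow> \<bar>of_int q * (x $ inv h i) - of_int (p i)\<bar> < 1 / N"
    using Dirichlet_approx_simult[OF assms, of "CARD('n)" "\<lambda>i. x $ inv h i"] by metis
  have hi: "h i < CARD('n)" "inv h (h i) = i" for i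
    using h bij_betwE[OF h] by (auto simp: bij_betw_def inv_f_f)
  show ?thesis
  proof (rule that[of "nat q" "\<chi> i. of_int (p (h i))"])
    show "\<bar>(real (nat q) *\<^sub>R x - (\<chi> i. of_int (p (h i)))) $ i\<bar> < 1 / N" for i
      using p[OF hi(1)[of i]] q(1) by (simp add: hi(2))
    have "int (nat q) \<le> int (N ^ CARD('n))"
      using q by simp
    then show "nat q \<le> N ^ CARD('n)"
      by (simp only: of_nat_le_iff)
  qed (use q in \<open>auto simp: int_vecs_def\<close>)
qed

text \<open>A lattice simplex with vertex \<open>v\<close> whose edge vectors at \<open>v\<close>
  are the columns of \<open>B\<close>. Invertibility is over the reals: the edges may span a proper
  sublattice, of index \<open>\<bar>det B\<bar>\<close>.\<close>

definition frame :: "'n::finite quadratic \<Rightarrow> real^'n \<Rightarrow> real^'n^'n \<Rightarrow> bool"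
  where "frame f v B \<longleftrightarrow> v \<in> zeros f \<and> (\<forall>i. v + B *v axis i 1 \<in> zeros f) \<and> invertible B"

lemma frame_int_mats: "frame f v B \<Longrightarrow> B \<in> int_mats"
  using int_vecs_diff[of "v + B *v axis i 1" v for i]
  by (auto simp: frame_def zeros_def int_mats_iff_columns)

text \<open>If \<open>w = B t\<close> is an integral vector whose coordinates in the frame are small, then
  \<open>Q[w] = \<Sum>\<^sub>i t\<^sub>i w \<bullet> Q (B e\<^sub>i)\<close> is a small combination of gradients of \<open>f\<close> at integral zeros along
  \<open>w\<close>, each of which is at most \<open>Q[w] / 2\<close>. Hence \<open>w = 0\<close>.\<close>

lemma frame_small_coords:
  fixes f :: "'n::finite quadratic"
  assumes f: "f \<in> positive_erdahl_cone" and fr: "frame f v B" and w: "B *v t \<in> int_vecs"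
    and t: "\<And>i. \<bar>t $ i\<bar> \<le> 1 / real (CARD('n) + 1)"
  shows "B *v t = 0"
proof -
  define w where "w = B *v t"
  define Q where "Q = Q_of f"
  define L where "L y = (b_of f + Q *v y) \<bullet> w" for y
  have pd: "pos_def Q" and sym: "transpose Q = Q"
    using f by (auto simp: positive_erdahl_cone_def Q_def pos_def_def)
  have bound: "\<bar>L y\<bar> \<le> qform Q w / 2" if "y \<in> zeros f" for y
    using erdahl_gradient_bound[OF f that, of w] w by (simp add: L_def Q_def w_def)
  have "qform Q w = w \<bullet> (Q *v (\<Sum>i\<in>UNIV. t $ i *\<^sub>R (B *v axis i 1)))"
    using matrix_vector_mult_axis_sum[of B t] by (simp add: qform_def w_def)
  also have "\<dots> = (\<Sum>i\<in>UNIV. t $ i * (w \<bullet> (Q *v (B *v axis i 1))))"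
    by (simp add: linear_sum[OF matrix_vector_mul_linear] inner_sum_right
        matrix_vector_mult_scaleR)
  also have "\<dots> = (\<Sum>i\<in>UNIV. t $ i * (L (v + B *v axis i 1) - L v))"
    by (simp add: L_def matrix_vector_right_distrib inner_add_left inner_commute[of w])
  also have "\<dots> \<le> (\<Sum>i\<in>(UNIV :: 'n set). 1 / real (CARD('n) + 1) * qform Q w)"
  proof (rule sum_mono)
    fix i
    have "\<bar>L (v + B *v axis i 1) - L v\<bar> \<le> qform Q w"
      using bound[of v] bound[of "v + B *v axis i 1"] fr by (fastforce simp: frame_def)
    then have "\<bar>t $ i\<bar> * \<bar>L (v + B *v axis i 1) - L v\<bar> \<le> 1 / real (CARD('n) + 1) * qform Q w"
      using t by (intro mult_mono) auto
    then show "t $ i * (L (v + B *v axis i 1) - L v) \<le> 1 / real (CARD('n) + 1) * qform Q w"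
      by (simp add: abs_mult[symmetric])
  qed
  \<comment> \<open>Each of the \<open>n\<close> edges contributes at most
    \<open>1 / (n + 1)\<close> of \<open>qform Q w\<close>, so the total factor stays below 1 and
    forces \<open>qform Q w \<le> 0\<close>.\<close>
  also have "\<dots> = real CARD('n) / real (CARD('n) + 1) * qform Q w"
    by simp
  finally have "qform Q w \<le> 0"
    by (simp add: field_simps)
  then have "qform Q w = 0"
    using pos_def_qform_nonneg[OF pd, of w] by simp
  then show ?thesis
    using pos_def_qform_eq_0[OF pd] by (simp add: w_def)
qed

text \<open>A common multiple of the denominators \<open>q \<le> (n + 1)^n\<close> from Dirichlet's theorem.\<close>

definition denom :: "nat \<Rightarrow> nat"
  where "denom n = fact ((n + 1) ^ n)"

lemma denom_pos: "denom n > 0"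
  by (simp add: denom_def)

text \<open>Dirichlet's theorem puts \<open>q x\<close> close to an integral \<open>p\<close> with
  \<open>q \<le> (n + 1)^n\<close>. Then \<open>B (q x - p)\<close> is integral with small
  coordinates, hence zero, so \<open>q x = p\<close>; and \<open>q\<close> divides
  \<open>denom n\<close>.\<close>

lemma frame_denominator:
  fixes f :: "'n::finite quadratic"
  assumes f: "f \<in> positive_erdahl_cone" and fr: "frame f v B" and x: "B *v x \<in> int_vecs"
  shows "real (denom CARD('n)) *\<^sub>R x \<in> int_vecs"
proof -
  obtain q p where q: "0 < q" "q \<le> (CARD('n) + 1) ^ CARD('n)" and p: "p \<in> int_vecs"
    and t: "\<And>i. \<bar>(real q *\<^sub>R x - p) $ i\<bar> < 1 / real (CARD('n) + 1)"
    using dirichlet_vec[of "CARD('n) + 1" x] by auto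
  have "B *v (real q *\<^sub>R x - p) \<in> int_vecs"
    using x p frame_int_mats[OF fr]
    by (simp add: matrix_vector_mult_diff_distrib matrix_vector_mult_scaleR int_vecs_diff
        int_vecs_scaleR int_mats_mult_vec)
  then have "B *v (real q *\<^sub>R x - p) = 0"
    using frame_small_coords[OF f fr] t by (meson less_imp_le)
  moreover have "inj ((*v) B)"
    using fr inj_matrix_vector_mult by (auto simp: frame_def)
  ultimately have "real q *\<^sub>R x = p"
    by (metis eq_iff_diff_eq_0 injD matrix_vector_mult_0_right)
  moreover obtain k where "denom CARD('n) = k * q"
    using dvd_fact[of q "(CARD('n) + 1) ^ CARD('n)"] q by (auto simp: denom_def dvd_def mult.commute)
  ultimately show ?thesis
    using int_vecs_scaleR[OF _ p, of "real k"] by auto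
qed

lemma det_int_mats: "A \<in> int_mats \<Longrightarrow> det A \<in> \<int>"
  by (auto simp: det_def int_mats_def intro!: Ints_sum Ints_mult Ints_prod)

text \<open>With \<open>K = denom n\<close> the matrix \<open>K B^-1\<close> is integral. Its
  nonzero determinant has absolute value at least 1, while its product with \<open>det B\<close> is
  \<open>K^n\<close>.\<close>

lemma frame_det_bound:
  fixes f :: "'n::finite quadratic"
  assumes f: "f \<in> positive_erdahl_cone" and fr: "frame f v B"
  shows "\<bar>det B\<bar> \<le> real (denom CARD('n)) ^ CARD('n)"
proof -
  define K where "K = real (denom CARD('n))"
  obtain C where C: "B ** C = mat 1"
    using fr by (auto simp: frame_def invertible_def)
  have "(K *\<^sub>R C) *v axis i 1 \<in> int_vecs" for i
    using frame_denominator[OF f fr, of "C *v axis i 1"]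
    by (simp add: matrix_vector_mul_assoc C axis_int_vecs K_def flip: scaleR_matrix_vector_assoc)
  then have "K *\<^sub>R C \<in> int_mats"
    by (simp add: int_mats_iff_columns)
  then have "det (K *\<^sub>R C) \<in> \<int>"
    by (rule det_int_mats)
  moreover have "B ** (K *\<^sub>R C) = K *\<^sub>R (B ** C)"
    by (simp only: matrix_scalar_ac scalar_matrix_assoc)
  then have "B ** (K *\<^sub>R C) = mat K"
    by (simp add: C mat_def vec_eq_iff)
  then have "det (B ** (K *\<^sub>R C)) = K ^ CARD('n)"
    by (simp add: det_matrix_scaleR[unfolded matrix_scaleR])
  then have e: "det B * det (K *\<^sub>R C) = K ^ CARD('n)"
    by (simp only: det_mul)
  moreover have "K ^ CARD('n) \<noteq> 0"
    using denom_pos[of "CARD('n)"] by (simp add: K_def)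
  ultimately have "1 \<le> \<bar>det (K *\<^sub>R C)\<bar>"
    by (metis Ints_nonzero_abs_ge1 mult_zero_right)
  then have "\<bar>det B\<bar> * 1 \<le> \<bar>det B\<bar> * \<bar>det (K *\<^sub>R C)\<bar>"
    by (intro mult_left_mono) auto
  also have "\<dots> = K ^ CARD('n)"
    using e by (simp add: abs_mult[symmetric] K_def)
  finally show ?thesis
    by (simp add: K_def)
qed

section \<open>Affinely spanning zero sets and frames of maximal determinant\<close>

text \<open>Says that the zeros affinely span the whole space; the dual form, through affine
  functions vanishing on them, is what perfection and eutaxy give directly.\<close>

definition full_zeros :: "'n::finite quadratic \<Rightarrow> bool"
  where "full_zeros f \<longleftrightarrow> (\<forall>p q. (\<forall>v\<in>zeros f. p + q \<bullet> v = 0) \<longrightarrow> p = 0 \<and> q = 0)"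

text \<open>A nonzero vector orthogonal to all differences \<open>x - v\<close> of zeros would give
  a nonzero affine function vanishing on the zeros. So the differences span, and a basis chosen
  among them supplies the columns of \<open>B\<close>.\<close>

lemma full_zeros_frame:
  fixes f :: "'n::finite quadratic"
  assumes "full_zeros f"
  shows "\<exists>v B. frame f v B"
proof -
  obtain v where v: "v \<in> zeros f"
    using assms[unfolded full_zeros_def, rule_format, of 1 0] by auto
  define D where "D = (\<lambda>x. x - v) ` zeros f"
  have "span D = UNIV"
  proof (rule ccontr)
    assume "span D \<noteq> UNIV"
    then obtain q where q: "q \<noteq> 0" "\<forall>x\<in>span D. q \<bullet> x = 0"
      using span_not_UNIV_orthogonal by blast
    have "- (q \<bullet> v) + q \<bullet> x = 0" if "x \<in> zeros f" for x
      using q(2) that span_base[of "x - v" D] by (auto simp: D_def inner_diff_right)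
    then show False
      using assms[unfolded full_zeros_def, rule_format, of "- (q \<bullet> v)" q] q(1) by blast
  qed
  moreover obtain S where S: "S \<subseteq> D" "independent S" "D \<subseteq> span S" "card S = dim D"
    using basis_exists by blast
  ultimately have "span S = UNIV" "card S = CARD('n)"
    using span_minimal[OF S(3)] dim_span[of D] by (auto simp: dim_UNIV)
  moreover have "finite S"
    using S(2) independent_imp_finite by blast
  ultimately obtain h :: "'n \<Rightarrow> real^'n" where h: "bij_betw h UNIV S"
    using finite_same_card_bij[of "UNIV :: 'n set" S] by auto
  define B :: "real^'n^'n" where "B = (\<chi> i j. h j $ i)"
  have B: "B *v axis j 1 = h j" for j
    by (simp add: B_def matrix_vector_mult_basis column_def vec_eq_iff)
  have "columns B = S"
    using h by (auto simp: columns_def bij_betw_def B matrix_vector_mult_basis[symmetric])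
  then have "invertible B"
    using \<open>span S = UNIV\<close> by (simp add: invertible_right_inverse matrix_right_invertible_span_columns span_vec_eq)
  moreover have "v + B *v axis j 1 \<in> zeros f" for j
  proof -
    have "h j \<in> D"
      using h S(1) by (auto simp: bij_betw_def)
    then show ?thesis
      by (auto simp: B D_def)
  qed
  ultimately show ?thesis
    using v by (auto simp: frame_def)
qed

text \<open>Only frames with the same base point \<open>v\<close> compete; this is enough because
  exchanging one edge keeps \<open>v\<close>.\<close>

definition max_frame :: "'n::finite quadratic \<Rightarrow> real^'n \<Rightarrow> real^'n^'n \<Rightarrow> bool"
  where "max_frame f v B \<longleftrightarrow> frame f v B \<and> (\<forall>C. frame f v C \<longrightarrow> \<bar>det C\<bar> \<le> \<bar>det B\<bar>)"

lemma max_frame_exists: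
  fixes f :: "'n::finite quadratic"
  assumes f: "f \<in> positive_erdahl_cone" and "full_zeros f"
  shows "\<exists>v B. max_frame f v B"
proof -
  obtain v B where B: "frame f v B"
    using full_zeros_frame[OF assms(2)] by blast
  define m where "m C = nat \<lfloor>\<bar>det C\<bar>\<rfloor>" for C :: "real^'n^'n"
  have m: "real (m C) = \<bar>det C\<bar>" if C: "frame f v C" for C
  proof -
    obtain z where "det C = of_int z"
      using det_int_mats[OF frame_int_mats[OF C]] by (rule Ints_cases)
    then show ?thesis
      by (simp add: m_def)
  qed
  have "\<forall>C. frame f v C \<longrightarrow> m C < Suc (denom CARD('n) ^ CARD('n))"
  proof (intro allI impI)
    fix C assume C: "frame f v C"
    have "real (m C) \<le> real (denom CARD('n) ^ CARD('n))"
      unfolding m[OF C] of_nat_power by (rule frame_det_bound[OF f C])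
    then show "m C < Suc (denom CARD('n) ^ CARD('n))"
      by (simp only: of_nat_le_iff less_Suc_eq_le)
  qed
  from ex_has_greatest_nat[OF B this]
  obtain C where C: "frame f v C" "\<forall>C'. frame f v C' \<longrightarrow> m C' \<le> m C"
    by blast
  have "\<bar>det C'\<bar> \<le> \<bar>det C\<bar>" if "frame f v C'" for C'
  proof -
    have "real (m C') \<le> real (m C)"
      using C(2) that by (simp only: of_nat_le_iff)
    then show ?thesis
      unfolding m[OF that] m[OF C(1)] .
  qed
  then show ?thesis
    using C(1) unfolding max_frame_def by blast
qed

text \<open>By Cramer's rule, exchanging column \<open>k\<close> for \<open>B *v x\<close>
  multiplies the determinant by \<open>x $ k\<close>; if this is nonzero the result is again a
  frame, and maximality bounds the factor.\<close>

lemma max_frame_coords: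
  fixes f :: "'n::finite quadratic"
  assumes "max_frame f v B" "v + B *v x \<in> zeros f"
  shows "\<bar>x $ k\<bar> \<le> 1"
proof (cases "x $ k = 0")
  case False
  have fr: "frame f v B"
    using assms(1) by (simp add: max_frame_def)
  then have nz: "det B \<noteq> 0"
    by (simp add: frame_def invertible_det_nz)
  define C where "C = (\<chi> i j. if j = k then (B *v x) $ i else B $ i $ j)"
  have det: "det C = x $ k * det B"
    unfolding C_def by (rule cramer_lemma)
  have "C *v axis j 1 = (if j = k then B *v x else B *v axis j 1)" for j
    by (simp add: C_def matrix_vector_mult_basis column_def vec_eq_iff)
  then have "frame f v C"
    using fr assms(2) False nz by (simp add: frame_def invertible_det_nz det)
  then have "\<bar>det C\<bar> \<le> \<bar>det B\<bar>"
    using assms(1) by (simp add: max_frame_def)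
  then have "\<bar>x $ k\<bar> * \<bar>det B\<bar> \<le> 1 * \<bar>det B\<bar>"
    by (simp only: det abs_mult mult_1)
  then show ?thesis
    using nz by simp
qed simp

section \<open>Finiteness of the frame data\<close>

text \<open>A finite set serving twice: for a function in the cone it contains the coordinates of
  all zeros in a maximal frame, and for any frame \<open>B\<close> it meets every class of
  \<open>frame_lattice B\<close> modulo integral vectors.\<close>

definition unit_box :: "(real^'n) set"
  where "unit_box = {x. real (denom CARD('n)) *\<^sub>R x \<in> int_vecs \<and> (\<forall>i. \<bar>x $ i\<bar> \<le> 1)}"

lemma finite_unit_box: "finite (unit_box :: (real^'n) set)"
proof -
  define K where "K = denom CARD('n)"
  have K: "K > 0"
    by (simp add: K_def denom_pos)
  let ?F = "\<lambda>h :: 'n \<Rightarrow> int. (\<chi> i. of_int (h i) / real K) :: real^'n"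
  have "x \<in> ?F ` (UNIV \<rightarrow>\<^sub>E {- int K..int K})" if "x \<in> unit_box" for x
  proof
    let ?h = "\<lambda>i. \<lfloor>real K * x $ i\<rfloor>"
    have h: "of_int (?h i) = real K * x $ i" for i
      using that by (auto simp: unit_box_def int_vecs_def K_def)
    show "x = ?F ?h"
      unfolding h using K by (simp add: vec_eq_iff)
    have "\<bar>of_int (?h i)\<bar> \<le> real K * 1" for i
      unfolding h abs_mult using that by (intro mult_mono) (auto simp: unit_box_def)
    then have "\<bar>?h i\<bar> \<le> int K" for i
      by (metis mult.right_neutral of_int_abs of_int_le_iff of_int_of_nat_eq)
    then show "?h \<in> UNIV \<rightarrow>\<^sub>E {- int K..int K}"
      by (auto simp: abs_le_iff minus_le_iff)
  qed
  then have "unit_box \<subseteq> ?F ` (UNIV \<rightarrow>\<^sub>E {- int K..int K})"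
    by blast
  moreover have "finite (?F ` ((UNIV :: 'n set) \<rightarrow>\<^sub>E {- int K..int K}))"
    by (intro finite_imageI finite_PiE) auto
  ultimately show ?thesis
    by (rule finite_subset)
qed

definition frame_lattice :: "real^'n^'n \<Rightarrow> (real^'n) set"
  where "frame_lattice B = {x. B *v x \<in> int_vecs}"

definition frame_zeros :: "'n::finite quadratic \<Rightarrow> real^'n \<Rightarrow> real^'n^'n \<Rightarrow> (real^'n) set"
  where "frame_zeros f v B = {x. v + B *v x \<in> zeros f}"

lemma frame_zeros_subset_unit_box:
  assumes f: "f \<in> positive_erdahl_cone" and m: "max_frame f v B"
  shows "frame_zeros f v B \<subseteq> unit_box"
proof
  fix x assume x: "x \<in> frame_zeros f v B"
  have fr: "frame f v B"
    using m by (simp add: max_frame_def)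
  have "B *v x \<in> int_vecs"
    using int_vecs_diff[of "v + B *v x" v] x fr
    by (simp add: frame_zeros_def frame_def zeros_def)
  then show "x \<in> unit_box"
    using frame_denominator[OF f fr] max_frame_coords[OF m, of x] x
    by (simp add: unit_box_def frame_zeros_def)
qed

text \<open>Subtracting the coordinatewise floor moves a lattice point into the box without changing
  membership, as integral vectors lie in both lattices.\<close>

lemma frame_lattice_subset:
  fixes f :: "'n::finite quadratic"
  assumes f: "f \<in> positive_erdahl_cone" and fr: "frame f v B" and C: "C \<in> int_mats"
    and sub: "frame_lattice B \<inter> unit_box \<subseteq> frame_lattice C"
  shows "frame_lattice B \<subseteq> frame_lattice C"
proof
  fix x assume x: "x \<in> frame_lattice B"
  define p :: "real^'n" where "p = (\<chi> i. of_int \<lfloor>x $ i\<rfloor>)"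
  have p: "p \<in> int_vecs"
    by (simp add: p_def int_vecs_def)
  have "x - p \<in> frame_lattice B"
    using x p frame_int_mats[OF fr]
    by (simp add: frame_lattice_def matrix_vector_mult_diff_distrib int_vecs_diff int_mats_mult_vec)
  moreover have "\<bar>(x - p) $ i\<bar> \<le> 1" for i
    by (simp add: p_def) linarith
  ultimately have "x - p \<in> frame_lattice C"
    using sub frame_denominator[OF f fr, of "x - p"] by (auto simp: unit_box_def frame_lattice_def)
  then show "x \<in> frame_lattice C"
    using int_vecs_add[of "C *v (x - p)" "C *v p"] int_mats_mult_vec[OF C p]
    by (simp add: frame_lattice_def matrix_vector_mult_diff_distrib)
qed

text \<open>\<open>C B^-1\<close> takes an integral \<open>u\<close> to its coordinates
  \<open>B^-1 u\<close> in the first frame and reads them in the second. Inclusion both ways will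
  make it unimodular.\<close>

lemma frame_transition_int:
  assumes "frame_lattice B \<subseteq> frame_lattice C" "B ** B' = mat 1"
  shows "C ** B' \<in> int_mats"
proof -
  have "C ** B' *v u \<in> int_vecs" if "u \<in> int_vecs" for u
  proof -
    have "B *v (B' *v u) = u"
      by (simp add: matrix_vector_mul_assoc assms(2))
    then have "B' *v u \<in> frame_lattice B"
      using that by (simp add: frame_lattice_def)
    then have "B' *v u \<in> frame_lattice C"
      using assms(1) by blast
    then show ?thesis
      by (simp add: frame_lattice_def matrix_vector_mul_assoc)
  qed
  then show ?thesis
    by (simp add: int_mats_iff_maps_int_vecs)
qed

section \<open>Substitution of affine maps into quadratic functions\<close>

definition pullback :: "real^'n \<Rightarrow> real^'n^'n \<Rightarrow> 'n::finite quadratic \<Rightarrow> 'n quadratic"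
  where "pullback w A f =
    (qeval f w, transpose A *v (b_of f + Q_of f *v w), transpose A ** Q_of f ** A)"

lemma Q_of_pullback: "Q_of (pullback w A f) = transpose A ** Q_of f ** A"
  by (simp add: pullback_def Q_of_def)

lemma pullback_quadratic: "f \<in> quadratic_functions \<Longrightarrow> pullback w A f \<in> quadratic_functions"
  by (simp add: quadratic_functions_def Q_of_pullback matrix_transpose_mul matrix_mul_assoc)

lemma qform_congruence: "qform (transpose A ** Q ** A) x = qform Q (A *v x)"
proof -
  have "qform (transpose A ** Q ** A) x = x \<bullet> (transpose A *v (Q *v (A *v x)))"
    by (simp add: qform_def matrix_vector_mul_assoc matrix_mul_assoc del: transpose_matrix_vector)
  also have "\<dots> = (A *v x) \<bullet> (Q *v (A *v x))"
    by (metis dot_lmul_matrix inner_commute transpose_matrix_vector)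
  finally show ?thesis
    by (simp add: qform_def)
qed

lemma qeval_pullback:
  assumes "f \<in> quadratic_functions"
  shows "qeval (pullback w A f) x = qeval f (w + A *v x)"
proof -
  have "b_of (pullback w A f) \<bullet> x = (b_of f + Q_of f *v w) \<bullet> (A *v x)"
    by (simp add: pullback_def b_of_def dot_lmul_matrix del: inner_add_left)
  then have "qeval (pullback w A f) x
      = qeval f w + 2 * ((b_of f + Q_of f *v w) \<bullet> (A *v x)) + qform (Q_of f) (A *v x)"
    by (simp only: qeval_def[of "pullback w A f"] Q_of_pullback qform_congruence)
       (simp add: pullback_def alpha_of_def)
  then show ?thesis
    using qeval_add[OF assms] by simp
qed

text \<open>The affine map \<open>x \<mapsto> w + C B^-1 (x - v)\<close> carries the first frame to
  the second. Equal lattices make it unimodular, equal zero coordinates make it match the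
  zeros.\<close>

lemma same_frame_data_imp_pullback:
  fixes f g :: "'n::finite quadratic"
  assumes f: "f \<in> positive_erdahl_cone" and g: "g \<in> positive_erdahl_cone"
    and frf: "frame f v B" and frg: "frame g w C"
    and lat: "frame_lattice B \<inter> unit_box = frame_lattice C \<inter> unit_box"
    and zer: "frame_zeros f v B = frame_zeros g w C"
  shows "\<exists>u\<in>int_vecs. \<exists>A\<in>GL_int. zeros f = zeros (pullback u A g)"
proof -
  obtain B' C' where B': "B ** B' = mat 1" "B' ** B = mat 1"
    and C': "C ** C' = mat 1" "C' ** C = mat 1"
    using frf frg by (auto simp: frame_def invertible_def)
  have "frame_lattice B = frame_lattice C"
    using frame_lattice_subset[OF f frf frame_int_mats[OF frg]]
      frame_lattice_subset[OF g frg frame_int_mats[OF frf]] lat by blast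
  then have int: "C ** B' \<in> int_mats" "B ** C' \<in> int_mats"
    using frame_transition_int[OF _ B'(1), of C] frame_transition_int[OF _ C'(1), of B] by simp_all
  have "(C ** B') ** (B ** C') = C ** (B' ** B) ** C'"
    "(B ** C') ** (C ** B') = B ** (C' ** C) ** B'"
    by (simp_all only: matrix_mul_assoc)
  then have GL: "C ** B' \<in> GL_int"
    using int B' C' by (auto simp: GL_int_def)
  define u where "u = w - C ** B' *v v"
  have v: "v \<in> int_vecs" "w \<in> int_vecs"
    using frf frg by (auto simp: frame_def zeros_def)
  then have u: "u \<in> int_vecs"
    using int by (simp add: u_def int_vecs_diff int_mats_mult_vec)
  have gq: "g \<in> quadratic_functions"
    using g by (simp add: positive_erdahl_cone_def)
  have key: "x \<in> zeros f \<longleftrightarrow> u + C ** B' *v x \<in> zeros g" for x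
  proof -
    define y where "y = B' *v (x - v)"
    have "v + B *v y = x"
      by (simp add: y_def matrix_vector_mul_assoc B')
    then have "x \<in> zeros f \<longleftrightarrow> y \<in> frame_zeros f v B"
      by (simp add: frame_zeros_def)
    moreover have "w + C *v y = u + C ** B' *v x"
      by (simp add: y_def u_def matrix_vector_mul_assoc matrix_vector_mult_diff_distrib)
    then have "y \<in> frame_zeros g w C \<longleftrightarrow> u + C ** B' *v x \<in> zeros g"
      by (simp add: frame_zeros_def)
    ultimately show ?thesis
      using zer by simp
  qed
  have "zeros f = zeros (pullback u (C ** B') g)"
  proof (intro set_eqI iffI)
    fix x assume "x \<in> zeros f"
    then show "x \<in> zeros (pullback u (C ** B') g)"
      using key[of x] by (auto simp: zeros_def qeval_pullback[OF gq])
  next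
    fix x assume "x \<in> zeros (pullback u (C ** B') g)"
    then have "u + C ** B' *v x \<in> zeros g"
      using u int by (auto simp: zeros_def qeval_pullback[OF gq] int_vecs_add int_mats_mult_vec)
    then show "x \<in> zeros f"
      using key by blast
  qed
  then show ?thesis
    using u GL by blast
qed

section \<open>From finite data to finitely many classes\<close>

lemma finite_quotient_fibers:
  assumes r: "equiv S r" and fin: "finite (\<Phi> ` X)"
    and fib: "\<And>x y. x \<in> X \<Longrightarrow> y \<in> X \<Longrightarrow> \<Phi> x = \<Phi> y \<Longrightarrow> (x, y) \<in> r"
  shows "finite (X // r)"
proof -
  have "X // r \<subseteq> (\<lambda>t. r `` {SOME x. x \<in> X \<and> \<Phi> x = t}) ` (\<Phi> ` X)"
  proof
    fix c assume "c \<in> X // r"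
    then obtain x where x: "x \<in> X" "c = r `` {x}"
      by (auto simp: quotient_def)
    define y where "y = (SOME y. y \<in> X \<and> \<Phi> y = \<Phi> x)"
    have "y \<in> X \<and> \<Phi> y = \<Phi> x"
      unfolding y_def by (rule someI[of _ x]) (use x in simp)
    then have "r `` {x} = r `` {y}"
      using equiv_class_eq[OF r] fib x(1) by metis
    then show "c \<in> (\<lambda>t. r `` {SOME x. x \<in> X \<and> \<Phi> x = t}) ` (\<Phi> ` X)"
      using x by (auto simp: y_def)
  qed
  then show ?thesis
    using fin finite_subset by blast
qed

text \<open>Sends \<open>f\<close> to its lattice and zeros in a chosen maximal frame, both read
  inside \<open>unit_box\<close>. The remaining burden is \<open>unique\<close>: zeros determine the
  function up to scaling. It compares with \<open>pullback w A g\<close> itself, so \<open>X\<close>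
  need not be shown closed under equivalence.\<close>

lemma finite_classes:
  fixes X :: "'n::finite quadratic set"
  assumes X: "X \<subseteq> positive_erdahl_cone" "\<And>f. f \<in> X \<Longrightarrow> full_zeros f"
    and unique: "\<And>f g w A. f \<in> X \<Longrightarrow> g \<in> X \<Longrightarrow> w \<in> int_vecs \<Longrightarrow> A \<in> GL_int \<Longrightarrow>
      zeros f = zeros (pullback w A g) \<Longrightarrow> \<exists>s>0. \<forall>x. qeval (pullback w A g) x = s * qeval f x"
  shows "finite (X // quad_equiv)"
proof -
  have "\<forall>f\<in>X. \<exists>vB. max_frame f (fst vB) (snd vB)"
    using max_frame_exists X by fastforce
  then obtain F where F: "\<And>f. f \<in> X \<Longrightarrow> max_frame f (fst (F f)) (snd (F f))"
    by metis
  define \<Phi> where "\<Phi> f = (frame_lattice (snd (F f)) \<inter> unit_box,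
      frame_zeros f (fst (F f)) (snd (F f)))" for f
  have "\<Phi> ` X \<subseteq> Pow unit_box \<times> Pow unit_box"
    using frame_zeros_subset_unit_box[OF _ F] X by (fastforce simp: \<Phi>_def)
  then have "finite (\<Phi> ` X)"
    using finite_unit_box finite_subset by (metis finite_Pow_iff finite_cartesian_product)
  moreover have "(f, g) \<in> quad_equiv" if fg: "f \<in> X" "g \<in> X" "\<Phi> f = \<Phi> g" for f g
  proof -
    have cone: "f \<in> positive_erdahl_cone" "g \<in> positive_erdahl_cone"
      using fg X by auto
    then have q: "f \<in> quadratic_functions" "g \<in> quadratic_functions"
      by (auto simp: positive_erdahl_cone_def)
    obtain w A where wA: "w \<in> int_vecs" "A \<in> GL_int" "zeros f = zeros (pullback w A g)"
      using same_frame_data_imp_pullback[OF cone, of "fst (F f)" "snd (F f)" "fst (F g)" "snd (F g)"]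
        F[OF fg(1)] F[OF fg(2)] fg(3) by (auto simp: max_frame_def \<Phi>_def)
    then obtain s where s: "s > 0" "\<forall>x. qeval (pullback w A g) x = s * qeval f x"
      using unique fg by blast
    then have "\<forall>x. qeval f x = 1 / s * qeval g (w + A *v x)"
      by (simp flip: qeval_pullback[OF q(2)])
    moreover have "1 / s > 0"
      using s by simp
    ultimately show ?thesis
      using q wA unfolding quad_equiv_def by blast
  qed
  ultimately show ?thesis
    using finite_quotient_fibers[OF equiv_quad_equiv] by blast
qed

section \<open>Perfect functions\<close>

lemma subspace_quadratic_functions: "subspace (quadratic_functions :: 'n::finite quadratic set)"
  by (auto simp: subspace_def quadratic_functions_def Q_of_def transpose_def vec_eq_iff)

lemma ev_quadratic: "ev v \<in> quadratic_functions"
  by (simp add: ev_def quadratic_functions_def Q_of_def transpose_def vec_eq_iff)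

lemma qeval_scaleR: "qeval (s *\<^sub>R f) x = s * qeval f x"
  by (simp add: qeval_def alpha_of_def b_of_def Q_of_def qform_def
      scaleR_matrix_vector_assoc[symmetric] algebra_simps)

text \<open>The Euclidean inner product of triples lacks the factor 2 in front of \<open>b\<^sub>f \<bullet> b\<^sub>g\<close>.\<close>

definition dual :: "'n::finite quadratic \<Rightarrow> 'n quadratic"
  where "dual f = (alpha_of f, 2 *\<^sub>R b_of f, Q_of f)"

lemma dual_inner_ev: "dual f \<bullet> ev v = qeval f v"
proof -
  have "Q_of f \<bullet> (\<chi> i j. v $ i * v $ j) = qform (Q_of f) v"
    by (simp add: qform_def inner_vec_def matrix_vector_mult_def sum_distrib_left algebra_simps)
  then show ?thesis
    by (simp add: dual_def ev_def qeval_def inner_prod_def)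
qed

lemma dual_inner_of_matrix:
  assumes "f \<in> quadratic_functions"
  shows "dual f \<bullet> of_matrix M = trace (Q_of f ** M)"
proof -
  have "Q_of f $ i $ j = Q_of f $ j $ i" for i j
    using assms by (metis (mono_tags, lifting) mem_Collect_eq quadratic_functions_def transpose_def vec_lambda_beta)
  then have "Q_of f \<bullet> M = (\<Sum>i\<in>UNIV. \<Sum>j\<in>UNIV. Q_of f $ j $ i * M $ i $ j)"
    by (simp add: inner_vec_def)
  also have "\<dots> = trace (Q_of f ** M)"
    unfolding trace_def matrix_matrix_mult_def by (subst sum.swap) simp
  finally show ?thesis
    by (simp add: dual_def of_matrix_def inner_prod_def)
qed

text \<open>A spanning set consists of the constant, the coordinate linear functions, and one
  symmetric 0-1 matrix \<open>E S\<close> for each set \<open>S\<close> of one or two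
  indices.\<close>

lemma dim_quadratic_functions_le:
  "dim (quadratic_functions :: 'n::finite quadratic set) \<le> (CARD('n) + 2) choose 2"
proof -
  define E :: "'n set \<Rightarrow> 'n quadratic"
    where "E S = (0, 0, \<chi> i j. if S = {i, j} then 1 else 0)" for S
  define e0 :: "'n quadratic" where "e0 = (1, 0, 0)"
  define e1 :: "'n \<Rightarrow> 'n quadratic" where "e1 i = (0, axis i 1, 0)" for i
  define T1 T2 :: "'n set set" where "T1 = {S. S \<subseteq> UNIV \<and> card S = 1}" and "T2 = {S. S \<subseteq> UNIV \<and> card S = 2}"
  define G where "G = {e0} \<union> range e1 \<union> E ` T1 \<union> E ` T2"
  have "card G \<le> card {e0} + card (range e1) + card (E ` T1) + card (E ` T2)"
    unfolding G_def by (meson card_Un_le add_mono le_trans order_refl)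
  also have "\<dots> \<le> 1 + CARD('n) + card T1 + card T2"
    by (intro add_mono card_image_le) auto
  also have "card T1 = CARD('n) choose 1"
    unfolding T1_def by (rule n_subsets) simp
  also have "card T2 = CARD('n) choose 2"
    unfolding T2_def by (rule n_subsets) simp
  also have "1 + CARD('n) + (CARD('n) choose 1) + (CARD('n) choose 2) = (CARD('n) + 2) choose 2"
    by (simp add: numeral_2_eq_2)
  finally have card: "card G \<le> (CARD('n) + 2) choose 2" .
  have "f \<in> span G" if f: "f \<in> quadratic_functions" for f
  proof -
    define Q where "Q = Q_of f"
    have sym: "Q $ i $ j = Q $ j $ i" for i j
      using f by (metis (mono_tags, lifting) Q_def mem_Collect_eq quadratic_functions_def
          transpose_def vec_lambda_beta)
    \<comment> \<open>The entry of \<open>Q\<close> belonging to an unordered pair of indices;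
      symmetry makes the choice unambiguous.\<close>
    define q where "q S = (SOME r. \<exists>i j. S = {i, j} \<and> r = Q $ i $ j)" for S
    have q: "q {i, j} = Q $ i $ j" for i j
      unfolding q_def using sym by (intro some_equality) (auto simp: doubleton_eq_iff)
    have T: "{i, j} \<in> T1 \<union> T2" for i j
      by (cases "i = j") (auto simp: T1_def T2_def)
    have Q_sum: "(\<Sum>S\<in>T1 \<union> T2. q S *\<^sub>R E S) = (0, 0, Q)"
    proof -
      have "snd (snd (\<Sum>S\<in>T1 \<union> T2. q S *\<^sub>R E S)) $ i $ j = Q $ i $ j" for i j
        using T[of i j] by (simp add: snd_sum E_def sum.delta q if_distrib cong: if_cong)
      moreover have "fst (snd (\<Sum>S\<in>T1 \<union> T2. q S *\<^sub>R E S)) = 0"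
        by (simp add: snd_sum fst_sum E_def)
      moreover have "fst (\<Sum>S\<in>T1 \<union> T2. q S *\<^sub>R E S) = 0"
        by (simp add: fst_sum E_def)
      ultimately show ?thesis
        by (simp add: prod_eq_iff vec_eq_iff)
    qed
    have b_sum: "(\<Sum>i\<in>UNIV. b_of f $ i *\<^sub>R e1 i) = (0, b_of f, 0)"
      by (simp add: prod_eq_iff fst_sum snd_sum e1_def vec_eq_iff axis_def if_distrib cong: if_cong)
    have "f = alpha_of f *\<^sub>R e0 + (\<Sum>i\<in>UNIV. b_of f $ i *\<^sub>R e1 i) + (\<Sum>S\<in>T1 \<union> T2. q S *\<^sub>R E S)"
      unfolding Q_sum b_sum by (simp add: e0_def prod_eq_iff alpha_of_def b_of_def Q_of_def Q_def)
    moreover have "\<dots> \<in> span G"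
      by (intro span_add span_sum span_scale span_base) (auto simp: G_def)
    ultimately show ?thesis
      by simp
  qed
  then have "dim (quadratic_functions :: 'n quadratic set) \<le> card G"
    by (intro dim_le_card) (auto simp: G_def)
  then show ?thesis
    using card by simp
qed

lemma Del_vertices_subset_zeros: "Del_vertices f \<subseteq> zeros f"
  by (auto simp: Del_vertices_def Del_def zeros_def dest: extreme_point_of_convex_hull)

lemma pos_def_neq_0: "pos_def (Q :: real^'n^'n) \<Longrightarrow> Q \<noteq> 0"
  by (auto simp: pos_def_def qform_def axis_eq_0_iff dest!: spec[of _ "axis undefined 1"])

text \<open>Under \<open>dual\<close>, functions vanishing on the zeros become vectors orthogonal to
  every \<open>ev v\<close>. Perfection leaves at most one dimension for these, and
  \<open>dual f\<close> already fills it.\<close>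

lemma perfect_line:
  fixes f :: "'n::finite quadratic"
  assumes f: "f \<in> positive_erdahl_cone" "perfect f"
    and g: "g \<in> quadratic_functions" "\<And>v. v \<in> zeros f \<Longrightarrow> qeval g v = 0"
  shows "\<exists>s. g = s *\<^sub>R f"
proof -
  define N where "N = (CARD('n) + 2) choose 2"
  define S where "S = span (ev ` zeros f)"
  define Y where "Y = {y \<in> quadratic_functions. \<forall>x\<in>S. orthogonal x y}"
  have "S \<subseteq> quadratic_functions"
    unfolding S_def by (intro span_minimal subspace_quadratic_functions) (auto simp: ev_quadratic)
  then have "dim Y + dim S = dim (quadratic_functions :: 'n quadratic set)"
    unfolding Y_def by (intro dim_subspace_orthogonal_to_vectors subspace_quadratic_functions)
      (simp_all add: S_def)
  moreover have "dim (span (ev ` Del_vertices f)) \<le> dim S"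
    unfolding S_def using Del_vertices_subset_zeros[of f] by (intro dim_subset span_mono image_mono)
  then have "N - 1 \<le> dim S"
    using f(2) by (simp add: perfect_def N_def)
  ultimately have "dim Y \<le> 1"
    using dim_quadratic_functions_le[where 'n='n] by (simp add: N_def)
  have sub: "subspace Y"
    using subspace_quadratic_functions[where 'n='n]
    by (auto simp: Y_def subspace_def orthogonal_clauses)
  have Y: "dual h \<in> Y" if "h \<in> quadratic_functions" "\<And>v. v \<in> zeros f \<Longrightarrow> qeval h v = 0" for h
  proof -
    have "orthogonal (dual h) x" if "x \<in> S" for x
      using \<open>x \<in> S\<close> unfolding S_def
      by (rule orthogonal_to_span)
         (auto simp: orthogonal_def dual_inner_ev \<open>\<And>v. v \<in> zeros f \<Longrightarrow> qeval h v = 0\<close>)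
    then show ?thesis
      using that(1) by (auto simp: Y_def orthogonal_commute dual_def quadratic_functions_def Q_of_def)
  qed
  have "f \<in> quadratic_functions"
    using f by (simp add: positive_erdahl_cone_def)
  then have fY: "dual f \<in> Y"
    by (intro Y) (auto simp: zeros_def)
  have "Q_of f \<noteq> 0"
    using f(1) pos_def_neq_0 by (auto simp: positive_erdahl_cone_def)
  then have "dual f \<noteq> 0"
    by (auto simp: dual_def zero_prod_def)
  then have "dim (span {dual f}) = 1"
    by simp
  then have "span {dual f} = Y"
    using \<open>dim Y \<le> 1\<close> sub fY by (intro subspace_dim_equal span_minimal) simp_all
  then obtain s where "dual g = s *\<^sub>R dual f"
    using Y[OF g] by (auto simp: span_singleton)
  then have "g = s *\<^sub>R f"
    by (simp add: dual_def prod_eq_iff alpha_of_def b_of_def Q_of_def vec_eq_iff)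
  then show ?thesis ..
qed

lemma Q_of_scaleR: "Q_of (s *\<^sub>R f) = s *\<^sub>R Q_of f"
  by (simp add: Q_of_def)

text \<open>An affine function is a quadratic function without quadratic part. If it vanishes on the
  zeros it is a multiple of \<open>f\<close>, and since \<open>Q_of f\<close> is nonzero the
  multiple is 0.\<close>

lemma perfect_full_zeros:
  assumes f: "f \<in> positive_erdahl_cone" "perfect f"
  shows "full_zeros f"
  unfolding full_zeros_def
proof (intro allI impI)
  fix p q assume pq: "\<forall>v\<in>zeros f. p + q \<bullet> v = 0"
  define g :: "'a quadratic" where "g = (p, (1/2) *\<^sub>R q, 0)"
  have "qeval g v = p + q \<bullet> v" for v
    by (simp add: g_def qeval_def alpha_of_def b_of_def Q_of_def qform_def)
  moreover have "g \<in> quadratic_functions"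
    by (simp add: g_def quadratic_functions_def Q_of_def transpose_def vec_eq_iff)
  ultimately obtain s where s: "g = s *\<^sub>R f"
    using perfect_line[OF f, of g] pq by auto
  have "s *\<^sub>R Q_of f = 0"
    using arg_cong[OF s, of Q_of] by (simp add: Q_of_scaleR) (simp add: g_def Q_of_def)
  moreover have "Q_of f \<noteq> 0"
    using f(1) pos_def_neq_0 by (auto simp: positive_erdahl_cone_def)
  ultimately have "g = 0"
    using s by simp
  then show "p = 0 \<and> q = 0"
    by (simp add: g_def zero_prod_def)
qed

lemma GL_int_inverse:
  assumes "A \<in> GL_int"
  obtains B where "B \<in> int_mats" "A ** B = mat 1" "B ** A = mat 1"
  using assms by (auto simp: GL_int_def)

lemma pos_def_pullback:
  assumes "pos_def (Q_of f)" "A \<in> GL_int"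
  shows "pos_def (Q_of (pullback w A f))"
proof -
  obtain B where B: "B ** A = mat 1"
    using GL_int_inverse[OF assms(2)] by blast
  have "A *v x \<noteq> 0" if "x \<noteq> 0" for x
    using that B by (metis matrix_vector_mul_assoc matrix_vector_mul_lid matrix_vector_mult_0_right)
  then show ?thesis
    using assms(1)
    by (simp add: pos_def_def Q_of_pullback qform_congruence matrix_transpose_mul matrix_mul_assoc)
qed

lemma perfect_unique:
  assumes f: "f \<in> positive_erdahl_cone" "perfect f"
    and g: "g \<in> quadratic_functions" "pos_def (Q_of g)" and z: "zeros f = zeros g"
  shows "\<exists>s>0. \<forall>x. qeval g x = s * qeval f x"
proof -
  obtain s where s: "g = s *\<^sub>R f"
    using perfect_line[OF f g(1)] z by (auto simp: zeros_def)
  have "qform (Q_of g) (axis undefined 1) = s * qform (Q_of f) (axis undefined 1)"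
    by (simp add: s Q_of_scaleR qform_axis)
  moreover have "qform (Q_of g) (axis undefined 1) > 0" "qform (Q_of f) (axis undefined 1) > 0"
    using g f by (auto simp: pos_def_def positive_erdahl_cone_def axis_eq_0_iff)
  ultimately have "s > 0"
    by (simp add: zero_less_mult_iff)
  then show ?thesis
    by (auto simp: s qeval_scaleR)
qed

lemma finite_perfect_classes:
  "finite ({f :: 'n::finite quadratic. f \<in> positive_erdahl_cone \<and> perfect f} // quad_equiv)"
proof (rule finite_classes)
  fix f g :: "'n quadratic" and w A
  assume "f \<in> {f. f \<in> positive_erdahl_cone \<and> perfect f}"
    "g \<in> {f. f \<in> positive_erdahl_cone \<and> perfect f}"
    and "w \<in> int_vecs" "A \<in> GL_int" "zeros f = zeros (pullback w A g)"
  then show "\<exists>s>0. \<forall>x. qeval (pullback w A g) x = s * qeval f x"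
    by (intro perfect_unique) (auto simp: positive_erdahl_cone_def pullback_quadratic pos_def_pullback)
qed (auto simp: perfect_full_zeros)

section \<open>Weakly eutactic functions\<close>

lemma matrix_vector_mult_uminus: "A *v (- x) = - (A *v x)"
  for A :: "'a::ring_1^'n^'m"
  by (simp add: matrix_vector_mult_def vec_eq_iff sum_negf)

lemma qeval_completed_square:
  fixes f :: "'n::finite quadratic"
  assumes "f \<in> positive_erdahl_cone"
  shows "qeval f x = qform (Q_of f) (x - center f) - mu f"
proof -
  have q: "f \<in> quadratic_functions" and pd: "pos_def (Q_of f)"
    using assms by (auto simp: positive_erdahl_cone_def)
  have "b_of f + Q_of f *v center f = 0"
    by (simp add: center_def matrix_vector_mult_uminus matrix_vector_mul_assoc pos_def_matrix_inv[OF pd])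
  then have e: "qeval f x = qeval f (center f) + qform (Q_of f) (x - center f)" for x
    using qeval_add[OF q, of "center f" "x - center f"]
    by (simp only: inner_zero_left add_diff_cancel_left' add_diff_eq mult_zero_right add_0_right)
  have "qeval f (center f) \<le> qeval f x" for x
    unfolding e[of x] using pos_def_qform_nonneg[OF pd, of "x - center f"] by simp
  then have "(INF x. qeval f x) = qeval f (center f)"
    by (intro cInf_eq_minimum) auto
  then show ?thesis
    using e[of x] by (simp add: mu_def)
qed

text \<open>Weak eutaxy as a functional equation: the coefficients \<open>a v\<close> disappear on pairing the
  eutaxy relation with the quadratic functions that vanish on the integral zeros of \<open>f\<close>.\<close>

definition eutactic_at :: "'n::finite quadratic \<Rightarrow> real^'n \<Rightarrow> real \<Rightarrow> bool"
  where "eutactic_at f c m \<longleftrightarrow>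
    (\<forall>x. qeval f x = qform (Q_of f) (x - c) - m) \<and>
    (\<forall>g\<in>quadratic_functions. (\<forall>v\<in>zeros f. qeval g v = 0) \<longrightarrow>
       qeval g c + m / real CARD('n) * trace (Q_of g ** matrix_inv (Q_of f)) = 0)"

lemma weakly_eutactic_imp_eutactic_at:
  fixes f :: "'n::finite quadratic"
  assumes "f \<in> positive_erdahl_cone" "weakly_eutactic f"
  shows "eutactic_at f (center f) (mu f)"
  unfolding eutactic_at_def
proof (intro conjI allI ballI impI)
  show "qeval f x = qform (Q_of f) (x - center f) - mu f" for x
    using qeval_completed_square[OF assms(1)] .
  fix g :: "'n quadratic" assume g: "g \<in> quadratic_functions" "\<forall>v\<in>zeros f. qeval g v = 0"
  obtain a :: "real^'n \<Rightarrow> real" where a: "(\<Sum>v\<in>Del_vertices f. a v *\<^sub>R ev v) =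
      ev (center f) + (mu f / real CARD('n)) *\<^sub>R of_matrix (matrix_inv (Q_of f))"
    using assms(2) unfolding weakly_eutactic_def by blast
  have "dual g \<bullet> (\<Sum>v\<in>Del_vertices f. a v *\<^sub>R ev v) = 0"
    unfolding inner_sum_right
    using g(2) Del_vertices_subset_zeros[of f] by (intro sum.neutral) (auto simp: dual_inner_ev)
  then show "qeval g (center f) + mu f / real CARD('n) * trace (Q_of g ** matrix_inv (Q_of f)) = 0"
    unfolding a by (simp add: inner_add_right dual_inner_ev dual_inner_of_matrix[OF g(1)])
qed

text \<open>Without zeros the constant function 1 would qualify as test function, and the functional
  equation would read 1 = 0.\<close>

lemma eutactic_at_zero_exists:
  assumes "eutactic_at f c m"
  obtains v where "v \<in> zeros f" "m = qform (Q_of f) (v - c)"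
proof -
  have "zeros f \<noteq> {}"
  proof
    assume "zeros f = {}"
    moreover have "(1, 0, 0) \<in> quadratic_functions"
      by (simp add: quadratic_functions_def Q_of_def transpose_def vec_eq_iff)
    ultimately have "qeval (1, 0, 0) c + m / real CARD('a) * trace (Q_of (1, 0, 0) ** matrix_inv (Q_of f)) = 0"
      using assms unfolding eutactic_at_def by blast
    then show False
      by (simp add: qeval_def alpha_of_def b_of_def Q_of_def qform_def trace_def)
  qed
  then obtain v where "v \<in> zeros f"
    by blast
  moreover have "qeval f v = qform (Q_of f) (v - c) - m"
    using assms by (simp add: eutactic_at_def)
  ultimately show ?thesis
    using that[of v] by (simp add: zeros_def)
qed

text \<open>The test function is the square of the affine function: the equation becomes a vanishing
  sum of two nonnegative terms, and positivity of \<open>m\<close> and of the inverse form makes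
  \<open>q\<close>, then \<open>p\<close>, vanish.\<close>

lemma eutactic_at_full_zeros:
  fixes f :: "'n::finite quadratic"
  assumes "eutactic_at f c m" "m > 0" "pos_def (Q_of f)"
  shows "full_zeros f"
  unfolding full_zeros_def
proof (intro allI impI)
  fix p q assume pq: "\<forall>v\<in>zeros f. p + q \<bullet> v = 0"
  define g :: "'n quadratic" where "g = (p\<^sup>2, p *\<^sub>R q, \<chi> i j. q $ i * q $ j)"
  have g: "qeval g v = (p + q \<bullet> v)\<^sup>2" for v
    by (simp add: g_def qeval_def alpha_of_def b_of_def Q_of_def qform_outer power2_sum)
  moreover have "g \<in> quadratic_functions"
    by (simp add: g_def quadratic_functions_def Q_of_def transpose_def vec_eq_iff)
  ultimately have "(p + q \<bullet> c)\<^sup>2 + m / real CARD('n) * trace (Q_of g ** matrix_inv (Q_of f)) = 0"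
    using assms(1) pq unfolding eutactic_at_def by auto
  moreover have "trace (Q_of g ** matrix_inv (Q_of f)) = qform (matrix_inv (Q_of f)) q"
    by (simp add: g_def Q_of_def trace_outer_mult)
  ultimately have e: "(p + q \<bullet> c)\<^sup>2 + m / real CARD('n) * qform (matrix_inv (Q_of f)) q = 0"
    by simp
  have "qform (matrix_inv (Q_of f)) q \<ge> 0"
    using pos_def_qform_nonneg pos_def_inverse assms(3) by blast
  then have "m / real CARD('n) * qform (matrix_inv (Q_of f)) q \<ge> 0"
    using assms(2) by simp
  then have "(p + q \<bullet> c)\<^sup>2 = 0" "m / real CARD('n) * qform (matrix_inv (Q_of f)) q = 0"
    using e zero_le_power2[of "p + q \<bullet> c"] by linarith+
  then have "p + q \<bullet> c = 0" "q = 0"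
    using assms(2) pos_def_qform_eq_0[OF pos_def_inverse[OF assms(3)]] by auto
  then show "p = 0 \<and> q = 0"
    by simp
qed

text \<open>With \<open>c\<close> and \<open>m\<close> as parameters, the centre and minimum of the
  pullback need not be computed afresh: \<open>c\<close> moves by the inverse map and
  \<open>m\<close> stays.\<close>

lemma eutactic_at_pullback:
  fixes g :: "'n::finite quadratic"
  assumes g: "g \<in> quadratic_functions" "pos_def (Q_of g)" "eutactic_at g c m"
    and w: "w \<in> int_vecs" and B: "B \<in> int_mats" "A ** B = mat 1" "B ** A = mat 1"
  shows "eutactic_at (pullback w A g) (B *v (c - w)) m"
proof -
  define h where "h = pullback w A g"
  define R where "R = Q_of g"
  have h: "qeval h x = qeval g (w + A *v x)" for x
    by (simp add: h_def qeval_pullback[OF g(1)])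
  have Qh: "Q_of h = transpose A ** R ** A"
    by (simp add: h_def Q_of_pullback R_def)
  have "w + A *v x - c = A *v (x - B *v (c - w))" for x
    by (simp add: matrix_vector_mult_diff_distrib matrix_vector_mul_assoc B)
  then have sq: "qeval h x = qform (Q_of h) (x - B *v (c - w)) - m" for x
    using g(3) by (simp add: h eutactic_at_def Qh qform_congruence flip: R_def)
  have tAB: "transpose A ** transpose B = mat 1"
    by (metis B(3) matrix_transpose_mul transpose_mat)
  have R: "R ** matrix_inv R = mat 1"
    using pos_def_matrix_inv[OF g(2)] by (simp add: R_def)
  have "Q_of h ** (B ** matrix_inv R ** transpose B)
      = transpose A ** (R ** ((A ** B) ** matrix_inv R)) ** transpose B"
    unfolding Qh by (simp only: matrix_mul_assoc)
  also have "\<dots> = mat 1"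
    by (simp add: B R tAB)
  finally have inv: "matrix_inv (Q_of h) = B ** matrix_inv R ** transpose B"
    by (rule matrix_inv_eqI)
  have "qeval k (B *v (c - w)) + m / real CARD('n) * trace (Q_of k ** matrix_inv (Q_of h)) = 0"
    if k: "k \<in> quadratic_functions" "\<forall>v\<in>zeros h. qeval k v = 0" for k
  proof -
    \<comment> \<open>\<open>k\<close> composed with the inverse map, so that the equation for
      \<open>g\<close> applies to it.\<close>
    define l where "l = pullback (- (B *v w)) B k"
    have l: "qeval l y = qeval k (B *v (y - w))" for y
      by (simp add: l_def qeval_pullback[OF k(1)] matrix_vector_mult_diff_distrib)
    have "qeval l v = 0" if v: "v \<in> zeros g" for v
    proof -
      have "w + A *v (B *v (v - w)) = v"
        by (simp add: matrix_vector_mul_assoc B)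
      then have "B *v (v - w) \<in> zeros h"
        using v w B(1) by (simp add: zeros_def h int_mats_mult_vec int_vecs_diff)
      then show ?thesis
        using k(2) by (simp add: l)
    qed
    moreover have "l \<in> quadratic_functions"
      using k(1) by (simp add: l_def pullback_quadratic)
    ultimately have "qeval l c + m / real CARD('n) * trace (Q_of l ** matrix_inv R) = 0"
      using g(3) by (simp add: eutactic_at_def R_def)
    moreover have "trace (Q_of l ** matrix_inv R) = trace (transpose B ** (Q_of k ** B ** matrix_inv R))"
      by (simp only: l_def Q_of_pullback matrix_mul_assoc)
    then have "trace (Q_of l ** matrix_inv R) = trace (Q_of k ** matrix_inv (Q_of h))"
      by (subst (asm) trace_mul_sym) (simp only: inv matrix_mul_assoc)
    ultimately show ?thesis
      by (simp add: l)
  qed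
  then show ?thesis
    using sq by (simp add: eutactic_at_def h_def)
qed

section \<open>A trace inequality and uniqueness from eutaxy\<close>

lemma matrix_diff_mult_right: "A ** (B - C) = A ** B - A ** C"
  for A :: "'a::ring_1^'n^'m"
  by (simp add: vec_eq_iff matrix_matrix_mult_def right_diff_distrib sum_subtractf)

lemma matrix_diff_mult_left: "(A - B) ** C = A ** C - B ** C"
  for A :: "'a::ring_1^'n^'m"
  by (simp add: vec_eq_iff matrix_matrix_mult_def left_diff_distrib sum_subtractf)

lemma trace_scaleR: "trace (s *\<^sub>R A) = s * trace A"
  for A :: "real^'n^'n"
  by (simp add: trace_def sum_distrib_left)

text \<open>The equality case of \<open>tr (R P\<^sup>-\<^sup>1) tr (P R\<^sup>-\<^sup>1) \<ge> n\<^sup>2\<close>: with \<open>D = R - s P\<close> the number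
  \<open>tr (D P\<^sup>-\<^sup>1 D R\<^sup>-\<^sup>1)\<close> is positive unless \<open>D = 0\<close>.\<close>

lemma trace_bounds_imp_proportional:
  fixes P R :: "real^'n^'n"
  assumes P: "pos_def P" and R: "pos_def R" and s: "s > 0"
    and 1: "trace (R ** matrix_inv P) \<le> s * real CARD('n)"
    and 2: "s * trace (P ** matrix_inv R) \<le> real CARD('n)"
  shows "R = s *\<^sub>R P"
proof (rule ccontr)
  assume ne: "R \<noteq> s *\<^sub>R P"
  define D where "D = R - s *\<^sub>R P"
  define P' R' where "P' = matrix_inv P" and "R' = matrix_inv R"
  have P': "P ** P' = mat 1" "pos_def P'" and R': "R ** R' = mat 1" "pos_def R'"
    using P R by (simp_all add: P'_def R'_def pos_def_matrix_inv pos_def_inverse)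
  have D: "transpose D = D" "D \<noteq> 0"
    using ne pos_def_symmetric[OF P] pos_def_symmetric[OF R]
    by (auto simp: D_def transpose_def vec_eq_iff)
  \<comment> \<open>This is \<open>D P^-1 D\<close>, with the first factor transposed to display a
    congruence and hence semidefiniteness.\<close>
  define A where "A = transpose D ** P' ** D"
  have q: "qform A x = qform P' (D *v x)" for x
    by (simp add: A_def qform_congruence)
  have "A \<noteq> 0"
  proof
    assume "A = 0"
    then have "qform P' (D *v x) = 0" for x
      using q[of x] by (simp add: qform_def)
    then have "D *v x = 0" for x
      using pos_def_qform_eq_0[OF P'(2)] by blast
    then have "D = 0"
      by (simp add: matrix_eq)
    then show False
      using D(2) by simp
  qed
  moreover have "transpose A = A"
    using pos_def_symmetric[OF P'(2)] by (simp add: A_def matrix_transpose_mul matrix_mul_assoc)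
  moreover have "0 \<le> qform A x" for x
    unfolding q by (rule pos_def_qform_nonneg[OF P'(2)])
  ultimately have pos: "0 < trace (A ** R')"
    using trace_psd_mult[OF R'(2), of A] by blast
  have DP: "D ** P' = R ** P' - s *\<^sub>R mat 1"
    by (simp add: D_def matrix_diff_mult_left P'(1) flip: scalar_matrix_assoc)
  have DR: "D ** R' = mat 1 - s *\<^sub>R (P ** R')"
    by (simp add: D_def matrix_diff_mult_left R'(1) flip: scalar_matrix_assoc)
  have "P' ** P = mat 1"
    using P'(1) matrix_left_right_inverse by blast
  then have "R ** P' ** (P ** R') = mat 1"
    by (metis R'(1) matrix_mul_assoc matrix_mul_rid)
  then have "(R ** P') ** (D ** R') = R ** P' - s *\<^sub>R mat 1"
    by (simp add: DR matrix_diff_mult_right matrix_scalar_ac flip: scalar_matrix_assoc)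
  moreover have "A ** R' = (D ** P') ** (D ** R')"
    by (simp add: A_def D(1) matrix_mul_assoc)
  ultimately have "A ** R' = R ** P' - s *\<^sub>R mat 1 - s *\<^sub>R (mat 1 - s *\<^sub>R (P ** R'))"
    by (simp add: DP matrix_diff_mult_left DR flip: scalar_matrix_assoc)
  then have "trace (A ** R') = trace (R ** P') - s * real CARD('n)
      - s * (real CARD('n) - s * trace (P ** R'))"
    by (simp only: trace_sub trace_scaleR trace_I)
  also have "\<dots> = trace (R ** P') - 2 * s * real CARD('n) + s * (s * trace (P ** R'))"
    by (simp add: algebra_simps)
  \<comment> \<open>The right-hand side is 0, against \<open>pos\<close>.\<close>
  also have "\<dots> \<le> s * real CARD('n) - 2 * s * real CARD('n) + s * real CARD('n)"
    using 1 2 s by (intro add_mono diff_mono mult_left_mono) (auto simp: P'_def R'_def)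
  finally show False
    using pos by simp
qed

text \<open>Each function vanishes on the zeros of the other, so it may be tested in the other's
  functional equation. Dropping the nonnegative value at the difference of centres gives the two
  trace bounds.\<close>

lemma eutactic_at_unique:
  fixes f g :: "'n::finite quadratic"
  assumes f: "f \<in> quadratic_functions" "pos_def (Q_of f)" "eutactic_at f c m" "m > 0"
    and g: "g \<in> quadratic_functions" "pos_def (Q_of g)" "eutactic_at g d k" "k > 0"
    and z: "zeros f = zeros g"
  shows "\<exists>s>0. \<forall>x. qeval g x = s * qeval f x"
proof -
  define P R where "P = Q_of f" and "R = Q_of g"
  define n where "n = real CARD('n)"
  define s where "s = k / m"
  have n: "n > 0" and s: "s > 0"
    using f(4) g(4) by (simp_all add: n_def s_def)
  have sqf: "qeval f x = qform P (x - c) - m" and sqg: "qeval g x = qform R (x - d) - k" for x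
    using f(3) g(3) by (simp_all add: eutactic_at_def P_def R_def)
  have "\<forall>v\<in>zeros f. qeval g v = 0"
    unfolding z by (simp add: zeros_def)
  then have "qeval g c + m / n * trace (R ** matrix_inv P) = 0"
    using f(3) g(1) unfolding eutactic_at_def P_def R_def n_def by blast
  then have 1: "qform R (c - d) + m / n * trace (R ** matrix_inv P) = k"
    by (simp add: sqg)
  have "\<forall>v\<in>zeros g. qeval f v = 0"
    unfolding z[symmetric] by (simp add: zeros_def)
  then have "qeval f d + k / n * trace (P ** matrix_inv R) = 0"
    using g(3) f(1) unfolding eutactic_at_def P_def R_def n_def by blast
  then have 2: "qform P (d - c) + k / n * trace (P ** matrix_inv R) = m"
    by (simp add: sqf)
  have pd: "pos_def P" "pos_def R"
    using f g by (simp_all add: P_def R_def)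
  have "m / n * trace (R ** matrix_inv P) \<le> k" "k / n * trace (P ** matrix_inv R) \<le> m"
    using 1 2 pos_def_qform_nonneg[OF pd(1), of "d - c"] pos_def_qform_nonneg[OF pd(2), of "c - d"]
    by linarith+
  then have PR: "R = s *\<^sub>R P"
    using n f(4) g(4) by (intro trace_bounds_imp_proportional pd s) (simp_all add: s_def n_def field_simps)
  \<comment> \<open>Now the trace term alone equals \<open>k\<close>, so nothing is left for
    \<open>qform R (c - d)\<close> and the centres agree.\<close>
  have "trace (R ** matrix_inv P) = s * n"
    by (simp add: PR pos_def_matrix_inv[OF pd(1)] trace_scaleR trace_I n_def flip: scalar_matrix_assoc)
  then have "qform R (c - d) = 0"
    using 1 n f(4) by (simp add: s_def)
  then have "c = d"
    using pos_def_qform_eq_0[OF pd(2)] by simp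
  moreover have "qform R x = s * qform P x" for x
    by (simp add: PR qform_def flip: scaleR_matrix_vector_assoc)
  moreover have "k = s * m"
    using f(4) by (simp add: s_def)
  ultimately have "\<forall>x. qeval g x = s * qeval f x"
    by (simp add: sqf sqg right_diff_distrib)
  then show ?thesis
    using s by blast
qed

lemma eutactic_mu_pos:
  assumes "f \<in> positive_erdahl_cone" "weakly_eutactic f" "mu f \<noteq> 0"
  shows "mu f > 0"
proof -
  obtain v where "mu f = qform (Q_of f) (v - center f)"
    using eutactic_at_zero_exists[OF weakly_eutactic_imp_eutactic_at[OF assms(1,2)]] by blast
  then show ?thesis
    using assms(1,3) pos_def_qform_nonneg[of "Q_of f" "v - center f"]
    by (simp add: positive_erdahl_cone_def)
qed

lemma finite_weakly_eutactic_classes: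
  "finite ({f :: 'n::finite quadratic. f \<in> positive_erdahl_cone \<and> weakly_eutactic f \<and> mu f \<noteq> 0}
     // quad_equiv)"
proof (rule finite_classes)
  fix f :: "'n quadratic"
  assume "f \<in> {f. f \<in> positive_erdahl_cone \<and> weakly_eutactic f \<and> mu f \<noteq> 0}"
  then have f: "f \<in> positive_erdahl_cone" "weakly_eutactic f" "mu f \<noteq> 0"
    by auto
  then have "pos_def (Q_of f)"
    by (simp add: positive_erdahl_cone_def)
  then show "full_zeros f"
    by (rule eutactic_at_full_zeros[OF weakly_eutactic_imp_eutactic_at[OF f(1,2)] eutactic_mu_pos[OF f]])
next
  fix f g :: "'n quadratic" and w A
  assume f: "f \<in> {f. f \<in> positive_erdahl_cone \<and> weakly_eutactic f \<and> mu f \<noteq> 0}"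
    and g: "g \<in> {f. f \<in> positive_erdahl_cone \<and> weakly_eutactic f \<and> mu f \<noteq> 0}"
    and w: "w \<in> int_vecs" and A: "A \<in> GL_int" and z: "zeros f = zeros (pullback w A g)"
  have q: "f \<in> quadratic_functions" "pos_def (Q_of f)" "g \<in> quadratic_functions" "pos_def (Q_of g)"
    using f g by (auto simp: positive_erdahl_cone_def)
  have e: "eutactic_at f (center f) (mu f)" "eutactic_at g (center g) (mu g)" "mu f > 0" "mu g > 0"
    using f g by (auto simp: weakly_eutactic_imp_eutactic_at eutactic_mu_pos)
  obtain B where B: "B \<in> int_mats" "A ** B = mat 1" "B ** A = mat 1"
    using GL_int_inverse[OF A] .
  show "\<exists>s>0. \<forall>x. qeval (pullback w A g) x = s * qeval f x"
    using eutactic_at_unique[OF q(1,2) e(1,3) pullback_quadratic[OF q(3)]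
        pos_def_pullback[OF q(4) A] eutactic_at_pullback[OF q(3,4) e(2) w B] e(4) z] .
qed auto

section \<open>The degenerate case \<open>mu f = 0\<close>\<close>

text \<open>Some integral zero has \<open>Q_of f\<close>-distance \<open>mu f = 0\<close> from the
  centre, so the centre is itself integral.\<close>

lemma weakly_eutactic_mu_0:
  fixes f :: "'n::finite quadratic"
  assumes "f \<in> positive_erdahl_cone" "weakly_eutactic f" "mu f = 0"
  obtains v where "v \<in> int_vecs" "\<And>x. qeval f x = qform (Q_of f) (x - v)"
proof -
  obtain v where v: "v \<in> zeros f" "mu f = qform (Q_of f) (v - center f)"
    using eutactic_at_zero_exists[OF weakly_eutactic_imp_eutactic_at[OF assms(1,2)]] by blast
  then have "v = center f"
    using assms pos_def_qform_eq_0[of "Q_of f" "v - center f"] by (simp add: positive_erdahl_cone_def)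
  then show ?thesis
    using that[of v] v(1) qeval_completed_square[OF assms(1)] assms(3) by (simp add: zeros_def)
qed

text \<open>Both functions are positive multiples of squares \<open>(x - v)^2\<close> with
  \<open>v\<close> integral, so a translation and a scaling relate them.\<close>

lemma equiv_one_dimensional:
  fixes f g :: "'n::finite quadratic"
  assumes n: "CARD('n) = 1"
    and f: "f \<in> positive_erdahl_cone" "weakly_eutactic f" "mu f = 0"
    and g: "g \<in> positive_erdahl_cone" "weakly_eutactic g" "mu g = 0"
  shows "(f, g) \<in> quad_equiv"
proof -
  obtain v w where v: "v \<in> int_vecs" "\<And>x. qeval f x = qform (Q_of f) (x - v)"
    and w: "w \<in> int_vecs" "\<And>x. qeval g x = qform (Q_of g) (x - w)"
    using weakly_eutactic_mu_0[OF f] weakly_eutactic_mu_0[OF g] by metis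
  obtain i :: 'n where i: "(UNIV :: 'n set) = {i}"
    using n card_1_singletonE by blast
  have q: "qform Q x = Q $ i $ i * (x $ i)\<^sup>2" for Q :: "real^'n^'n" and x
    by (simp add: qform_def inner_vec_def matrix_vector_mult_def i power2_eq_square)
  define c where "c = Q_of f $ i $ i / Q_of g $ i $ i"
  have pos: "Q_of h $ i $ i > 0" if "h \<in> positive_erdahl_cone" for h :: "'n quadratic"
    using that by (auto simp: positive_erdahl_cone_def pos_def_def axis_eq_0_iff simp flip: qform_axis)
  then have "c > 0"
    using f(1) g(1) by (simp add: c_def)
  moreover have "\<forall>x. qeval f x = c * qeval g ((w - v) + mat 1 *v x)"
    using pos[OF g(1)] by (simp add: v w q c_def)
  moreover have "(mat 1 :: real^'n^'n) \<in> int_mats"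
    by (auto simp: int_mats_def mat_def)
  then have "(mat 1 :: real^'n^'n) \<in> GL_int"
    by (auto simp: GL_int_def intro!: bexI[of _ "mat 1"])
  moreover have "w - v \<in> int_vecs"
    using v w by (simp add: int_vecs_diff)
  ultimately show ?thesis
    using f(1) g(1) unfolding quad_equiv_def positive_erdahl_cone_def by blast
qed

theorem theorem5p1:
  "finite ({f :: 'n::finite quadratic. f \<in> positive_erdahl_cone \<and> perfect f} // quad_equiv) \<and>
   finite ({f :: 'n quadratic. f \<in> positive_erdahl_cone \<and> weakly_eutactic f \<and>
              (mu f \<noteq> 0 \<or> CARD('n) = 1)} // quad_equiv)"
proof
  show "finite ({f :: 'n quadratic. f \<in> positive_erdahl_cone \<and> perfect f} // quad_equiv)"
    by (rule finite_perfect_classes)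
  let ?E = "{f :: 'n quadratic. f \<in> positive_erdahl_cone \<and> weakly_eutactic f \<and> mu f \<noteq> 0}"
  let ?D = "{f :: 'n quadratic. f \<in> positive_erdahl_cone \<and> weakly_eutactic f \<and>
      mu f = 0 \<and> CARD('n) = 1}"
  have "finite (?D // quad_equiv)"
    by (rule finite_quotient_fibers[OF equiv_quad_equiv, where \<Phi> = "\<lambda>_. ()"])
       (auto intro: equiv_one_dimensional)
  with finite_weakly_eutactic_classes have "finite ((?E \<union> ?D) // quad_equiv)"
    by (simp only: quotient_def UN_Un finite_Un)
  moreover have "{f :: 'n quadratic. f \<in> positive_erdahl_cone \<and> weakly_eutactic f \<and>
      (mu f \<noteq> 0 \<or> CARD('n) = 1)} = ?E \<union> ?D"
    by blast
  ultimately show "finite ({f :: 'n quadratic. f \<in> positive_erdahl_cone \<and> weakly_eutactic f \<and>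
      (mu f \<noteq> 0 \<or> CARD('n) = 1)} // quad_equiv)"
    by (simp only:)
qed

end
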